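(* Let $T>0$. (i) Assume that there exists a solution $Y$ of the non-linear stochastic equation $$Y_t = Y_0+\int_0^t \Phi(u(s,Y_s))\,dW_s,\qquad \text{law density of } Y_t = u(t,\cdot),\qquad t\in[0,T].$$ Then $u:[0,T]\times\mathbb{R}\to\mathbb{R}_+$ is a solution in the sense of distributions of $$\partial_t u=\tfrac12\,\partial^2_{xx}(\beta(u)),\qquad u(0,\cdot)=u_0,$$ with $u_0:=u(0,\cdot)$. (ii) Let $u$ be a solution, in the sense of distributions, of $\partial_t u=\frac12\partial^2_{xx}(\beta(u))$ with $u(0,\cdot)=u_0$, and let $Y$ solve $Y_t=Y_0+\int_0^t\Phi(u(s,Y_s))\,dW_s$, where $Y_t$ has law density $v(t,\cdot)$ and the initial law density is $u_0=u(0,\cdot)$. Then $$\partial_t v=\tfrac12\,\partial^2_{xx}(\Phi^2(u)\,v)$$ in the sense of distributions. In particular, if $v$ is the unique solution of this last (linear) equation with $v(0,\cdot)=u_0$, then $v=u$.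
   Context: Standing assumptions: $\beta:\mathbb{R}\to\mathbb{R}$ is monotone increasing; $|\beta(u)|\le \mathrm{const}\,|u|$ for all $u\in\mathbb{R}$; there is $\lambda>0$ such that $(\beta+\lambda\,\mathrm{id})(x)\to\mp\infty$ as $x\to\mp\infty$; and $u_0\in L^1(\mathbb{R})\cap L^\infty(\mathbb{R})$ is a probability density. One writes $\beta(u)=\Phi^2(u)\,u$ with $\Phi$ a non-negative bounded Borel function on $\mathbb{R}$. $W$ is a Brownian motion on some filtered probability space $(\Omega,\mathcal F,(\mathcal F_t)_{t\ge0},P)$ and the solution $Y$ is a continuous adapted process on it (equations are understood in the weak sense, i.e. the probability space and $W$ are part of the solution). "Law density of $Y_t$ is $u(t,\cdot)$" means that the law of $Y_t$ has density $u(t,\cdot)$ with respect to Lebesgue measure on $\mathbb{R}$. "$w$ solves $\partial_t w=\frac12\partial^2_{xx}(F)$, $w(0,\cdot)=u_0$, in the sense of distributions" (where $F=\beta(u)$ or $F=\Phi^2(u)v$) means that for all $\varphi\in C_0^\infty(\mathbb{R})$ and $t\in[0,T]$, $\int_{\mathbb{R}}\varphi(x)w(t,x)\,dx=\int_{\mathbb{R}}\varphi(x)u_0(x)\,dx+\frac12\int_0^t\int_{\mathbb{R}}\varphi''(x)F(s,x)\,dx\,ds$. *)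

theory Defs
  imports "HOL-Probability.Probability"
begin

section \<open>Weak solutions of the porous media type equation\<close>

definition test_function :: "(real \<Rightarrow> real) \<Rightarrow> bool" where
  "test_function \<phi> \<longleftrightarrow>
     (\<forall>n x. (deriv ^^ n) \<phi> differentiable (at x)) \<and> compact (closure (support_on UNIV \<phi>))"

text \<open>
  \<open>w\<close> solves \<open>\<partial>\<^sub>t w = 1/2 \<partial>\<^sub>x\<^sub>x F\<close>, \<open>w(0, \<cdot>) = u0\<close> on \<open>[0, T] \<times> \<real>\<close> in the sense of distributions.
  The first three clauses make the integrals in the weak formulation exist; they are
  needed because \<^const>\<open>lebesgue_integral\<close> is 0 on non-integrable functions.
  Only the values of \<open>w\<close> and \<open>F\<close> at times in \<open>[0, T]\<close> matter.
  The initial condition is the case \<open>t = 0\<close> of the last clause.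
\<close>

definition distributional_solution ::
  "real \<Rightarrow> (real \<Rightarrow> real \<Rightarrow> real) \<Rightarrow> (real \<Rightarrow> real \<Rightarrow> real) \<Rightarrow> (real \<Rightarrow> real) \<Rightarrow> bool" where
  "distributional_solution T w F u0 \<longleftrightarrow>
     set_borel_measurable lborel ({0..T} \<times> UNIV) (\<lambda>(t, x). w t x) \<and>
     (\<forall>t\<in>{0..T}. \<forall>R. set_integrable lborel {-R..R} (w t)) \<and>
     (\<forall>R. set_integrable lborel ({0..T} \<times> {-R..R}) (\<lambda>(t, x). F t x)) \<and>
     (\<forall>\<phi>. test_function \<phi> \<longrightarrow> (\<forall>t\<in>{0..T}.
        (LINT x|lborel. \<phi> x * w t x) =
        (LINT x|lborel. \<phi> x * u0 x) +
        1/2 * (LINT s:{0..t}|lborel. (LINT x|lborel. (deriv ^^ 2) \<phi> x * F s x))))"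

text \<open>
  Uniqueness for the linear equation \<open>\<partial>\<^sub>t v = 1/2 \<partial>\<^sub>x\<^sub>x (a v)\<close>, \<open>v(0, \<cdot>) = u0\<close>, in the class of
  all distributional solutions, functions being identified if they agree for every
  \<open>t\<close> at almost every \<open>x\<close>.
\<close>

definition unique_linear_solution ::
  "real \<Rightarrow> (real \<Rightarrow> real \<Rightarrow> real) \<Rightarrow> (real \<Rightarrow> real) \<Rightarrow> (real \<Rightarrow> real \<Rightarrow> real) \<Rightarrow> bool" where
  "unique_linear_solution T a u0 v \<longleftrightarrow>
     distributional_solution T v (\<lambda>s x. a s x * v s x) u0 \<and>
     (\<forall>w. distributional_solution T w (\<lambda>s x. a s x * w s x) u0 \<longrightarrow>
        (\<forall>t\<in>{0..T}. AE x in lborel. w t x = v t x))"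


section \<open>Stochastic processes\<close>

definition filtered_prob_space :: "'a measure \<Rightarrow> (real \<Rightarrow> 'a measure) \<Rightarrow> bool" where
  "filtered_prob_space M F \<longleftrightarrow>
     prob_space M \<and> (\<forall>t\<ge>0. subalgebra M (F t)) \<and>
     (\<forall>s t. 0 \<le> s \<and> s \<le> t \<longrightarrow> sets (F s) \<subseteq> sets (F t))"

definition adapted_on :: "real set \<Rightarrow> (real \<Rightarrow> 'a measure) \<Rightarrow> (real \<Rightarrow> 'a \<Rightarrow> real) \<Rightarrow> bool" where
  "adapted_on I F X \<longleftrightarrow> (\<forall>t\<in>I. X t \<in> borel_measurable (F t))"

definition continuous_paths_on :: "real set \<Rightarrow> 'a measure \<Rightarrow> (real \<Rightarrow> 'a \<Rightarrow> real) \<Rightarrow> bool" where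
  "continuous_paths_on I M X \<longleftrightarrow> (\<forall>\<omega>\<in>space M. continuous_on I (\<lambda>t. X t \<omega>))"

definition brownian_motion ::
  "'a measure \<Rightarrow> (real \<Rightarrow> 'a measure) \<Rightarrow> (real \<Rightarrow> 'a \<Rightarrow> real) \<Rightarrow> bool" where
  "brownian_motion M F W \<longleftrightarrow>
     adapted_on {0..} F W \<and> continuous_paths_on {0..} M W \<and> (AE \<omega> in M. W 0 \<omega> = 0) \<and>
     (\<forall>s t. 0 \<le> s \<and> s < t \<longrightarrow>
        distributed M lborel (\<lambda>\<omega>. W t \<omega> - W s \<omega>)
          (\<lambda>x. ennreal (normal_density 0 (sqrt (t - s)) x)) \<and>
        prob_space.indep_set M (sets (F s))
          (sets (vimage_algebra (space M) (\<lambda>\<omega>. W t \<omega> - W s \<omega>) borel)))"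

definition progressively_measurable ::
  "real \<Rightarrow> (real \<Rightarrow> 'a measure) \<Rightarrow> (real \<Rightarrow> 'a \<Rightarrow> real) \<Rightarrow> bool" where
  "progressively_measurable T F H \<longleftrightarrow>
     (\<forall>t\<in>{0..T}. (\<lambda>(s, \<omega>). H s \<omega>) \<in> borel_measurable (restrict_space borel {0..t} \<Otimes>\<^sub>M F t))"


section \<open>The Ito integral\<close>

text \<open>
  A simple process \<open>\<Sum>i<n. \<xi>\<^sub>i 1\<^bsub>(\<tau>\<^sub>i, \<tau>\<^sub>i\<^sub>+\<^sub>1]\<^esub>\<close> is given by the number \<open>n\<close> of steps, the
  deterministic partition \<open>\<tau>\<close> and the heights \<open>\<xi>\<close>.
\<close>

definition simple_process_data ::
  "real \<Rightarrow> 'a measure \<Rightarrow> (real \<Rightarrow> 'a measure) \<Rightarrow> nat \<Rightarrow> (nat \<Rightarrow> real) \<Rightarrow> (nat \<Rightarrow> 'a \<Rightarrow> real) \<Rightarrow> bool"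
  where
  "simple_process_data T M F n \<tau> \<xi> \<longleftrightarrow>
     (\<forall>i\<le>n. \<tau> i \<in> {0..T}) \<and> (\<forall>i<n. \<tau> i \<le> \<tau> (Suc i)) \<and>
     (\<forall>i<n. \<xi> i \<in> borel_measurable (F (\<tau> i))) \<and>
     (\<exists>C. \<forall>i<n. \<forall>\<omega>\<in>space M. \<bar>\<xi> i \<omega>\<bar> \<le> C)"

definition simple_process ::
  "nat \<Rightarrow> (nat \<Rightarrow> real) \<Rightarrow> (nat \<Rightarrow> 'a \<Rightarrow> real) \<Rightarrow> real \<Rightarrow> 'a \<Rightarrow> real" where
  "simple_process n \<tau> \<xi> t \<omega> = (\<Sum>i<n. \<xi> i \<omega> * indicator {\<tau> i<..\<tau> (Suc i)} t)"

definition simple_integral ::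
  "(real \<Rightarrow> 'a \<Rightarrow> real) \<Rightarrow> nat \<Rightarrow> (nat \<Rightarrow> real) \<Rightarrow> (nat \<Rightarrow> 'a \<Rightarrow> real) \<Rightarrow> real \<Rightarrow> 'a \<Rightarrow> real" where
  "simple_integral W n \<tau> \<xi> t \<omega> =
     (\<Sum>i<n. \<xi> i \<omega> * (W (min t (\<tau> (Suc i))) \<omega> - W (min t (\<tau> i)) \<omega>))"

text \<open>
  \<open>I\<^sub>t = \<integral>\<^sub>0\<^sup>t H dW\<close> for \<open>t \<in> [0, T]\<close>: \<open>I\<close> is the continuous adapted process which is, at
  each time, the \<open>L\<^sup>2(P)\<close> limit of the integrals of simple processes approximating \<open>H\<close> in
  \<open>L\<^sup>2([0, T] \<times> \<Omega>)\<close>. By the Ito isometry the limit does not depend on the approximating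
  sequence, so \<open>I\<close> is determined up to indistinguishability.
\<close>

definition has_ito_integral ::
  "'a measure \<Rightarrow> (real \<Rightarrow> 'a measure) \<Rightarrow> (real \<Rightarrow> 'a \<Rightarrow> real) \<Rightarrow> real \<Rightarrow>
   (real \<Rightarrow> 'a \<Rightarrow> real) \<Rightarrow> (real \<Rightarrow> 'a \<Rightarrow> real) \<Rightarrow> bool" where
  "has_ito_integral M F W T H I \<longleftrightarrow>
     progressively_measurable T F H \<and>
     (\<integral>\<^sup>+\<omega>. (\<integral>\<^sup>+s\<in>{0..T}. ennreal ((H s \<omega>)\<^sup>2) \<partial>lborel) \<partial>M) < \<infinity> \<and>
     adapted_on {0..T} F I \<and> continuous_paths_on {0..T} M I \<and>
     (\<exists>n \<tau> \<xi>.
        (\<forall>k::nat. simple_process_data T M F (n k) (\<tau> k) (\<xi> k)) \<and>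
        (\<lambda>k. \<integral>\<^sup>+\<omega>. (\<integral>\<^sup>+s\<in>{0..T}.
            ennreal ((simple_process (n k) (\<tau> k) (\<xi> k) s \<omega> - H s \<omega>)\<^sup>2) \<partial>lborel) \<partial>M)
          \<longlonglongrightarrow> 0 \<and>
        (\<forall>t\<in>{0..T}.
          (\<lambda>k. \<integral>\<^sup>+\<omega>. ennreal ((simple_integral W (n k) (\<tau> k) (\<xi> k) t \<omega> - I t \<omega>)\<^sup>2) \<partial>M)
            \<longlonglongrightarrow> 0))"


section \<open>The stochastic equations\<close>

text \<open>
  \<open>Y\<^sub>t = Y\<^sub>0 + \<integral>\<^sub>0\<^sup>t \<sigma>(s, Y\<^sub>s) dW\<^sub>s\<close> for \<open>t \<in> [0, T]\<close>. As solutions are understood in the weak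
  sense, the filtered probability space and \<open>W\<close> are part of the solution.
\<close>

definition sde_solution ::
  "real \<Rightarrow> (real \<Rightarrow> real \<Rightarrow> real) \<Rightarrow>
   'a measure \<Rightarrow> (real \<Rightarrow> 'a measure) \<Rightarrow> (real \<Rightarrow> 'a \<Rightarrow> real) \<Rightarrow> (real \<Rightarrow> 'a \<Rightarrow> real) \<Rightarrow> bool" where
  "sde_solution T \<sigma> M F W Y \<longleftrightarrow>
     filtered_prob_space M F \<and> brownian_motion M F W \<and>
     adapted_on {0..T} F Y \<and> continuous_paths_on {0..T} M Y \<and>
     (\<exists>I. has_ito_integral M F W T (\<lambda>s \<omega>. \<sigma> s (Y s \<omega>)) I \<and>
        (\<forall>t\<in>{0..T}. AE \<omega> in M. Y t \<omega> = Y 0 \<omega> + I t \<omega>))"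

text \<open>
  The densities form a Borel function \<open>[0, T] \<times> \<real> \<rightarrow> \<real>\<^sub>+\<close>. Joint measurability does not
  follow from the other clauses, as each \<open>v(t, \<cdot>)\<close> is only determined almost everywhere.
\<close>

definition has_law_density ::
  "real \<Rightarrow> 'a measure \<Rightarrow> (real \<Rightarrow> 'a \<Rightarrow> real) \<Rightarrow> (real \<Rightarrow> real \<Rightarrow> real) \<Rightarrow> bool" where
  "has_law_density T M Y v \<longleftrightarrow>
     set_borel_measurable lborel ({0..T} \<times> UNIV) (\<lambda>(t, x). v t x) \<and>
     (\<forall>t\<in>{0..T}. (\<forall>x. 0 \<le> v t x) \<and> distributed M lborel (Y t) (\<lambda>x. ennreal (v t x)))"

end

theory Submission
  imports Defs
begin

text \<open>
  Both parts rest on one fact. If \<open>Y\<close> solves \<open>dY = \<sigma>(s, Y\<^sub>s) dW\<close> with bounded \<open>\<sigma>\<close>, then for every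
  test function \<open>\<phi>\<close>
  \<open>E \<phi>(Y\<^sub>t) = E \<phi>(Y\<^sub>0) + 1/2 \<integral>\<^sub>0\<^sup>t E (\<phi>''(Y\<^sub>s) \<sigma>(s, Y\<^sub>s)\<^sup>2) ds\<close>,
  the expectation of Ito's formula. If \<open>Y\<^sub>s\<close> has density \<open>v(s, \<cdot>)\<close>, the three expectations are
  integrals against \<open>v\<close>, and the identity says that \<open>v\<close> solves
  \<open>\<partial>\<^sub>t v = 1/2 \<partial>\<^sub>x\<^sub>x (\<sigma>\<^sup>2 v)\<close> weakly (\<open>distributional_solution_of_sde\<close>). With \<open>\<sigma> = \<Phi>(u)\<close> this is
  the equation of part (ii). In part (i) moreover \<open>v = u\<close>, and \<open>\<Phi>(u)\<^sup>2 u = \<beta>(u)\<close>. For the same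
  reason a solution \<open>u\<close> of the nonlinear equation solves the linear equation with coefficient
  \<open>\<Phi>(u)\<^sup>2\<close>, so uniqueness there forces \<open>v = u\<close>.

  The expectation of Ito's formula can be computed directly. While the integrand is constant, a
  third-order Taylor expansion and the moments of an independent Gaussian increment identify the
  derivative of \<open>E \<phi>(X\<^sub>s)\<close> (\<open>ito_expectation_constant_height\<close>). Telescoping over a partition
  yields the formula for simple integrands (\<open>ito_expectation_simple_process\<close>). The Ito integral is
  an \<open>L\<^sup>2\<close> limit of simple integrals, and both sides of the formula are continuous along this limit
  because the derivatives of \<open>\<phi>\<close> and the integrand \<open>\<sigma>(s, Y\<^sub>s)\<close> are bounded
  (\<open>ito_expectation\<close>).
\<close>

section \<open>Analytic preliminaries\<close>

text \<open>
  A first-order expansion of \<open>g\<close> to the right, with an error that is uniform and of higher order,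
  already makes \<open>G\<close> the two-sided derivative of \<open>g\<close>: for an increment to the left one expands at
  the other end point and pays for it with the Hoelder continuity of \<open>G\<close>. For \<open>g s = E f(X s)\<close>
  the expansion to the right is the one that independence of Brownian increments provides.
\<close>

lemma FTC_of_increment_estimate:
  fixes g G :: "real \<Rightarrow> real"
  assumes "a \<le> b"
    and incr: "\<And>s s'. a \<le> s \<Longrightarrow> s \<le> s' \<Longrightarrow> s' \<le> b \<Longrightarrow>
                 \<bar>g s' - g s - (s' - s) * G s\<bar> \<le> c * ((s' - s) * sqrt (s' - s))"
    and holder: "\<And>s s'. a \<le> s \<Longrightarrow> s \<le> s' \<Longrightarrow> s' \<le> b \<Longrightarrow> \<bar>G s' - G s\<bar> \<le> c * sqrt (s' - s)"
  shows "has_bochner_integral lborel (\<lambda>s. indicator {a..b} s * G s) (g b - g a)"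
proof -
  have holder': "\<bar>G y - G s\<bar> \<le> c * sqrt \<bar>y - s\<bar>" if "s \<in> {a..b}" "y \<in> {a..b}" for s y
    using holder[of s y] holder[of y s] that by (cases "s \<le> y") (auto simp: abs_minus_commute)
  \<comment> \<open>For \<open>y < s\<close> the expansion takes place at \<open>y\<close>; replacing \<open>G y\<close> by \<open>G s\<close> costs
      \<open>(s - y) * c * sqrt (s - y)\<close>, which doubles the constant.\<close>
  have incr': "\<bar>g y - g s - (y - s) * G s\<bar> \<le> 2 * c * (\<bar>y - s\<bar> * sqrt \<bar>y - s\<bar>)"
    if s: "s \<in> {a..b}" and y: "y \<in> {a..b}" for s y
  proof (cases "s \<le> y")
    case True
    then have "\<bar>g y - g s - (y - s) * G s\<bar> \<le> c * (\<bar>y - s\<bar> * sqrt \<bar>y - s\<bar>)"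
      using incr[of s y] s y by auto
    moreover from this have "0 \<le> c * (\<bar>y - s\<bar> * sqrt \<bar>y - s\<bar>)" by linarith
    ultimately show ?thesis by linarith
  next
    case False
    have "g y - g s - (y - s) * G s = - (g s - g y - (s - y) * G y) + (s - y) * (G s - G y)"
      by (simp add: algebra_simps)
    then have "\<bar>g y - g s - (y - s) * G s\<bar> \<le> \<bar>g s - g y - (s - y) * G y\<bar> + \<bar>s - y\<bar> * \<bar>G s - G y\<bar>"
      unfolding abs_mult[symmetric] by linarith
    also have "\<dots> \<le> c * (\<bar>y - s\<bar> * sqrt \<bar>y - s\<bar>) + \<bar>s - y\<bar> * (c * sqrt \<bar>y - s\<bar>)"
      using incr[of y s] holder'[OF y s] False s y
      by (intro add_mono mult_left_mono) (auto simp: abs_minus_commute)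
    finally show ?thesis by (simp add: abs_minus_commute algebra_simps)
  qed
  have sq0: "((\<lambda>y. k * sqrt \<bar>y - s\<bar>) \<longlongrightarrow> 0) (at s within {a..b})" for s k
  proof -
    have "((\<lambda>y. k * sqrt \<bar>y - s\<bar>) \<longlongrightarrow> k * sqrt \<bar>s - s\<bar>) (at s within {a..b})"
      by (intro tendsto_intros)
    then show ?thesis by simp
  qed
  have "continuous_on {a..b} G"
    unfolding continuous_on_def
  proof
    fix s assume s: "s \<in> {a..b}"
    have "((\<lambda>y. G y - G s) \<longlongrightarrow> 0) (at s within {a..b})"
      by (rule Lim_null_comparison[OF _ sq0[of c s]])
         (auto simp: eventually_at_filter s intro!: always_eventually holder'[OF s])
    then show "(G \<longlongrightarrow> G s) (at s within {a..b})"
      by (simp add: LIM_zero_iff)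
  qed
  moreover have "(g has_vector_derivative G s) (at s within {a..b})" if "a \<le> s" "s \<le> b" for s
  proof -
    have s: "s \<in> {a..b}" using that by simp
    have "((\<lambda>y. (g y - g s) / (y - s) - G s) \<longlongrightarrow> 0) (at s within {a..b})"
    proof (rule Lim_null_comparison[OF _ sq0[of "2 * c" s]])
      have "\<bar>(g y - g s) / (y - s) - G s\<bar> \<le> 2 * c * sqrt \<bar>y - s\<bar>" if "y \<noteq> s" "y \<in> {a..b}" for y
      proof -
        have "(g y - g s) / (y - s) - G s = (g y - g s - (y - s) * G s) / (y - s)"
          using that by (simp add: field_simps)
        also have "\<bar>\<dots>\<bar> \<le> 2 * c * sqrt \<bar>y - s\<bar>"
          using incr'[OF s that(2)] that by (simp add: field_simps)
        finally show ?thesis .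
      qed
      then show "\<forall>\<^sub>F y in at s within {a..b}.
          norm ((g y - g s) / (y - s) - G s) \<le> 2 * c * sqrt \<bar>y - s\<bar>"
        by (simp add: eventually_at_filter)
    qed
    then show ?thesis
      by (simp add: has_real_derivative_iff_has_vector_derivative[symmetric]
          has_field_derivative_iff LIM_zero_iff)
  qed
  ultimately show ?thesis
    using has_bochner_integral_FTC_Icc[OF \<open>a \<le> b\<close>, of g G] by simp
qed

locale bounded_C3 =
  fixes f f' f'' f''' :: "real \<Rightarrow> real" and B :: real
  assumes deriv0: "(f has_real_derivative f' x) (at x)"
    and deriv1: "(f' has_real_derivative f'' x) (at x)"
    and deriv2: "(f'' has_real_derivative f''' x) (at x)"
    and bound0: "\<bar>f x\<bar> \<le> B" and bound1: "\<bar>f' x\<bar> \<le> B"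
    and bound2: "\<bar>f'' x\<bar> \<le> B" and bound3: "\<bar>f''' x\<bar> \<le> B"
begin

lemma B_nonneg: "0 \<le> B"
  using bound0[of 0] by linarith

lemma borel_measurable_derivs [measurable]:
  "f \<in> borel_measurable borel" "f' \<in> borel_measurable borel" "f'' \<in> borel_measurable borel"
  by (rule borel_measurable_continuous_onI, rule DERIV_continuous_on,
      rule has_field_derivative_at_within, rule deriv0 deriv1 deriv2)+

lemma lipschitz: "\<bar>f y - f x\<bar> \<le> B * \<bar>y - x\<bar>"
  using field_differentiable_bound[of UNIV f f' B y x] deriv0 bound1 by simp

lemma lipschitz2: "\<bar>f'' y - f'' x\<bar> \<le> B * \<bar>y - x\<bar>"
  using field_differentiable_bound[of UNIV f'' f''' B y x] deriv2 bound3 by simp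

lemma taylor: "\<bar>f (x + d) - f x - f' x * d - f'' x * d\<^sup>2 / 2\<bar> \<le> B * \<bar>d\<bar> ^ 3"
proof -
  define diff where "diff n d = (if n = 0 then f else if n = 1 then f' else if n = 2 then f''
      else f''') (x + d)" for n :: nat and d
  have sh: "((\<lambda>d. h (x + d)) has_real_derivative h' (x + t)) (at t)"
    if "\<And>x. (h has_real_derivative h' x) (at x)" for h h' t
    using DERIV_shift[of h "h' (t + x)" t x] that by (simp add: add.commute)
  have D: "DERIV (diff m) t :> diff (Suc m) t" if "m < 3" for m t
  proof -
    from that consider "m = 0" | "m = 1" | "m = 2" by linarith
    then show ?thesis
      by cases (auto simp: diff_def[abs_def] intro!: sh deriv0 deriv1 deriv2)
  qed
  have "diff 0 = (\<lambda>d. f (x + d))" by (simp add: diff_def[abs_def])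
  then obtain t where t: "f (x + d) = (\<Sum>m<3. (diff m 0 / fact m) * d ^ m) + diff 3 t / fact 3 * d ^ 3"
    using Maclaurin_bi_le[of diff "\<lambda>d. f (x + d)" 3 d] D by blast
  have "{..<3::nat} = {0, 1, 2}" by auto
  moreover have "fact 3 = (6 :: real)" "fact 2 = (2 :: real)" by (simp_all add: fact_numeral)
  ultimately have "f (x + d) - f x - f' x * d - f'' x * d\<^sup>2 / 2 = f''' (x + t) * d ^ 3 / 6"
    unfolding t by (simp add: diff_def)
  moreover have "\<bar>f''' (x + t)\<bar> * \<bar>d\<bar> ^ 3 / 6 \<le> B * \<bar>d\<bar> ^ 3"
  proof -
    have "\<bar>f''' (x + t)\<bar> * \<bar>d\<bar> ^ 3 \<le> B * \<bar>d\<bar> ^ 3"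
      by (intro mult_right_mono bound3) simp
    moreover have "0 \<le> B * \<bar>d\<bar> ^ 3" using B_nonneg by simp
    ultimately show ?thesis by simp
  qed
  ultimately show ?thesis by (simp only: abs_mult abs_divide power_abs abs_numeral)
qed

end

text \<open>
  Outside the closed support a test function vanishes on an open set, so all its derivatives vanish
  there too; on the compact support they are bounded by continuity.
\<close>

lemma test_function_imp_bounded_C3:
  assumes "test_function \<phi>"
  obtains B where "bounded_C3 \<phi> (deriv \<phi>) ((deriv ^^ 2) \<phi>) ((deriv ^^ 3) \<phi>) B"
proof -
  define K where "K = closure (support_on UNIV \<phi>)"
  have diff: "((deriv ^^ n) \<phi> has_real_derivative (deriv ^^ Suc n) \<phi> x) (at x)" for n x
    using assms by (simp add: test_function_def DERIV_deriv_iff_real_differentiable)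
  have K: "compact K" using assms by (simp add: test_function_def K_def)
  have zero: "(deriv ^^ n) \<phi> x = 0" if "x \<notin> K" for n x
    using that
  proof (induction n arbitrary: x)
    case 0
    then show ?case using closure_subset[of "support_on UNIV \<phi>"] by (auto simp: K_def support_on_def)
  next
    case (Suc n)
    have "open (- K)" using K by (simp add: compact_imp_closed open_Compl)
    then have "((\<lambda>_. 0) has_real_derivative (deriv ^^ Suc n) \<phi> x) (at x)"
      using has_field_derivative_transform_within_open[OF diff[of n x], of "- K" "\<lambda>_. 0"] Suc by auto
    then show ?case using DERIV_const DERIV_unique by blast
  qed
  have "\<exists>B. \<forall>x. \<bar>(deriv ^^ n) \<phi> x\<bar> \<le> B" for n
  proof -
    have "continuous_on K ((deriv ^^ n) \<phi>)"
      by (rule DERIV_continuous_on) (rule has_field_derivative_at_within[OF diff])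
    then have "bounded ((deriv ^^ n) \<phi> ` K)"
      by (intro compact_imp_bounded compact_continuous_image K)
    then obtain B where "\<And>x. x \<in> K \<Longrightarrow> \<bar>(deriv ^^ n) \<phi> x\<bar> \<le> B"
      unfolding bounded_iff by auto
    then have "\<bar>(deriv ^^ n) \<phi> x\<bar> \<le> max B 0" for x
      using zero[of x n] by (cases "x \<in> K") (auto simp: le_max_iff_disj)
    then show ?thesis by blast
  qed
  then obtain b where b: "\<And>n x. \<bar>(deriv ^^ n) \<phi> x\<bar> \<le> b n" by metis
  define C where "C = (\<Sum>n\<le>3. b n)"
  have "0 \<le> b n" for n using b[of n 0] by linarith
  then have "b n \<le> C" if "n \<le> 3" for n
    unfolding C_def using that by (intro member_le_sum) auto
  then have C: "\<bar>(deriv ^^ n) \<phi> x\<bar> \<le> C" if "n \<le> 3" for n x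
    using b that order_trans by blast
  have step: "Suc 0 = 1" "Suc 1 = 2" "Suc 2 = 3" by simp_all
  have low: "(deriv ^^ 0) \<phi> = \<phi>" "(deriv ^^ 1) \<phi> = deriv \<phi>" by (rule ext, simp)+
  have "bounded_C3 ((deriv ^^ 0) \<phi>) ((deriv ^^ 1) \<phi>) ((deriv ^^ 2) \<phi>) ((deriv ^^ 3) \<phi>) C"
    by (rule bounded_C3.intro; (rule C diff[of 0, unfolded step] diff[of 1, unfolded step]
          diff[of 2, unfolded step])?) simp_all
  then have "bounded_C3 \<phi> (deriv \<phi>) ((deriv ^^ 2) \<phi>) ((deriv ^^ 3) \<phi>) C"
    unfolding low .
  then show thesis by (rule that)
qed

text \<open>
  On a finite measure space, the Cauchy-Schwarz inequality against the constant 1 turns \<open>L\<^sup>2\<close>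
  convergence into \<open>L\<^sup>1\<close> convergence. It serves both for \<open>P\<close> and for the product of Lebesgue measure
  on \<open>[0, T]\<close> with \<open>P\<close>.
\<close>

lemma nn_integral_abs_tendsto_0_of_square:
  fixes Z :: "nat \<Rightarrow> 'a \<Rightarrow> real"
  assumes [measurable]: "\<And>k. Z k \<in> borel_measurable N"
    and fin: "emeasure N (space N) < \<infinity>"
    and lim: "(\<lambda>k. \<integral>\<^sup>+x. ennreal ((Z k x)\<^sup>2) \<partial>N) \<longlonglongrightarrow> 0"
  shows "(\<lambda>k. \<integral>\<^sup>+x. ennreal \<bar>Z k x\<bar> \<partial>N) \<longlonglongrightarrow> 0"
proof -
  let ?A = "\<lambda>k. \<integral>\<^sup>+x. ennreal \<bar>Z k x\<bar> \<partial>N"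
  have "(?A k)\<^sup>2 \<le> (\<integral>\<^sup>+x. ennreal ((Z k x)\<^sup>2) \<partial>N) * emeasure N (space N)" for k
    using Cauchy_Schwarz_nn_integral[of "\<lambda>x. ennreal \<bar>Z k x\<bar>" N "\<lambda>_. 1"]
    by (simp add: ennreal_power)
  moreover have "(\<lambda>k. (\<integral>\<^sup>+x. ennreal ((Z k x)\<^sup>2) \<partial>N) * emeasure N (space N)) \<longlonglongrightarrow> 0"
    using ennreal_tendsto_cmult[OF fin[unfolded infinity_ennreal_def] lim] by (simp add: mult.commute)
  ultimately have sq: "(\<lambda>k. (?A k)\<^sup>2) \<longlonglongrightarrow> 0"
    by (intro tendsto_sandwich[where f = "\<lambda>_. 0" and g = "\<lambda>k. (?A k)\<^sup>2", OF _ _ tendsto_const]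
        always_eventually allI) (rule zero_le)
  have pos: "\<forall>\<^sub>F k in sequentially. ?A k < e" if "0 < e" for e
  proof -
    have "0 < e\<^sup>2" using that by (simp add: power2_eq_square ennreal_zero_less_mult_iff)
    then have "\<forall>\<^sub>F k in sequentially. (?A k)\<^sup>2 < e\<^sup>2" by (rule order_tendstoD(2)[OF sq])
    then show ?thesis
    proof (rule eventually_mono)
      fix k assume "(?A k)\<^sup>2 < e\<^sup>2"
      then show "?A k < e"
        by (rule contrapos_pp) (simp add: not_less power_mono)
    qed
  qed
  show ?thesis
    by (rule order_tendstoI) (use pos in simp_all)
qed

lemma abs_integral_le:
  fixes Z U :: "'a \<Rightarrow> real"
  assumes "integrable M Z" "integrable M U" "\<And>\<omega>. \<omega> \<in> space M \<Longrightarrow> \<bar>Z \<omega>\<bar> \<le> U \<omega>"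
  shows "\<bar>integral\<^sup>L M Z\<bar> \<le> integral\<^sup>L M U"
proof -
  have "integral\<^sup>L M (\<lambda>\<omega>. \<bar>Z \<omega>\<bar>) \<le> integral\<^sup>L M U"
    using assms by (intro integral_mono integrable_abs) auto
  then show ?thesis using integral_abs_bound[of M Z] by linarith
qed

section \<open>Increments of Brownian motion\<close>

locale brownian_space = prob_space M for M :: "'a measure" +
  fixes F :: "real \<Rightarrow> 'a measure" and W :: "real \<Rightarrow> 'a \<Rightarrow> real"
  assumes filtration: "filtered_prob_space M F"
    and brownian: "brownian_motion M F W"
begin

lemma subalgebra_filtration: "0 \<le> t \<Longrightarrow> subalgebra M (F t)"
  using filtration by (simp add: filtered_prob_space_def)

lemma measurable_filtration_M: "0 \<le> t \<Longrightarrow> X \<in> borel_measurable (F t) \<Longrightarrow> X \<in> borel_measurable M"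
  using measurable_from_subalg[OF subalgebra_filtration] .

lemma measurable_filtration_mono:
  assumes "0 \<le> s" "s \<le> t" "X \<in> borel_measurable (F s)"
  shows "X \<in> borel_measurable (F t)"
proof -
  have "subalgebra (F t) (F s)"
    using subalgebra_filtration[of s] subalgebra_filtration[of t] filtration assms
    by (auto simp: subalgebra_def filtered_prob_space_def)
  then show ?thesis using assms(3) by (rule measurable_from_subalg)
qed

lemma measurable_brownian: "0 \<le> t \<Longrightarrow> W t \<in> borel_measurable (F t)"
  using brownian by (simp add: brownian_motion_def adapted_on_def)

lemma measurable_increment:
  "0 \<le> s \<Longrightarrow> 0 \<le> t \<Longrightarrow> (\<lambda>\<omega>. W t \<omega> - W s \<omega>) \<in> borel_measurable M"
  by (intro borel_measurable_diff measurable_filtration_M[OF _ measurable_brownian])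

lemma expectation_mult_increment:
  fixes g :: "real \<Rightarrow> real"
  assumes st: "0 \<le> s" "s < t" and Z: "Z \<in> borel_measurable (F s)" "integrable M Z"
    and g: "g \<in> borel_measurable borel" "integrable M (\<lambda>\<omega>. g (W t \<omega> - W s \<omega>))"
  shows "expectation (\<lambda>\<omega>. Z \<omega> * g (W t \<omega> - W s \<omega>)) =
           expectation Z * expectation (\<lambda>\<omega>. g (W t \<omega> - W s \<omega>))"
    and "integrable M (\<lambda>\<omega>. Z \<omega> * g (W t \<omega> - W s \<omega>))"
proof -
  let ?D = "\<lambda>\<omega>. W t \<omega> - W s \<omega>"
  have D: "?D \<in> borel_measurable M"
    using st by (intro measurable_increment) auto
  have gD: "(\<lambda>\<omega>. g (?D \<omega>)) \<in> borel_measurable M"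
    using D g(1) by (rule measurable_compose)
  have ZM: "Z \<in> borel_measurable M" using Z(2) by simp
  have ind: "indep_set (sets (F s)) (sets (vimage_algebra (space M) ?D borel))"
    using brownian st by (simp add: brownian_motion_def)
  \<comment> \<open>Both generated \<open>\<sigma>\<close>-algebras are contained in the independent ones of the definition of
      Brownian motion.\<close>
  have 1: "sigma_sets (space M) {Z -` A \<inter> space M |A. A \<in> sets borel} \<subseteq> sets (F s)"
  proof -
    have sp: "space (F s) = space M" using subalgebra_filtration[OF st(1)] by (simp add: subalgebra_def)
    have "{Z -` A \<inter> space M |A. A \<in> sets borel} \<subseteq> sets (F s)"
      using Z(1) by (auto simp: measurable_def sp)
    then show ?thesis using sets.sigma_sets_subset[of _ "F s"] by (simp add: sp)
  qed
  have 2: "sigma_sets (space M) {(\<lambda>\<omega>. g (?D \<omega>)) -` A \<inter> space M |A. A \<in> sets borel}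
      \<subseteq> sets (vimage_algebra (space M) ?D borel)"
  proof -
    have "{(\<lambda>\<omega>. g (?D \<omega>)) -` A \<inter> space M |A. A \<in> sets borel}
        \<subseteq> sets (vimage_algebra (space M) ?D borel)"
    proof clarify
      fix A :: "real set" assume "A \<in> sets borel"
      then have "g -` A \<in> sets borel" using measurable_sets[OF g(1)] by simp
      moreover have "(\<lambda>\<omega>. g (?D \<omega>)) -` A \<inter> space M = ?D -` (g -` A) \<inter> space M" by auto
      ultimately show "(\<lambda>\<omega>. g (?D \<omega>)) -` A \<inter> space M \<in> sets (vimage_algebra (space M) ?D borel)"
        using in_vimage_algebra by metis
    qed
    then show ?thesis
      using sets.sigma_sets_subset[of _ "vimage_algebra (space M) ?D borel"] by simp
  qed
  have "indep_var borel Z borel (\<lambda>\<omega>. g (?D \<omega>))"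
    unfolding indep_var_eq indep_sets2_eq
  proof (intro conjI)
    let ?A = "sigma_sets (space M) {Z -` A \<inter> space M |A. A \<in> sets borel}"
    let ?B = "sigma_sets (space M) {(\<lambda>\<omega>. g (?D \<omega>)) -` A \<inter> space M |A. A \<in> sets borel}"
    show "?A \<subseteq> events" "?B \<subseteq> events" "\<forall>a\<in>?A. \<forall>b\<in>?B. prob (a \<inter> b) = prob a * prob b"
      using 1 2 ind unfolding indep_sets2_eq by blast+
  qed (use ZM gD in auto)
  from indep_var_lebesgue_integral[OF this Z(2) g(2)] indep_var_integrable[OF this Z(2) g(2)]
  show "expectation (\<lambda>\<omega>. Z \<omega> * g (?D \<omega>)) = expectation Z * expectation (\<lambda>\<omega>. g (?D \<omega>))"
    "integrable M (\<lambda>\<omega>. Z \<omega> * g (?D \<omega>))" by simp_all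
qed

lemma increment_moments:
  assumes st: "0 \<le> s" "s \<le> t"
  shows integrable_increment_power: "integrable M (\<lambda>\<omega>. (W t \<omega> - W s \<omega>) ^ k)"
    and expectation_increment: "expectation (\<lambda>\<omega>. W t \<omega> - W s \<omega>) = 0"
    and expectation_increment_square: "expectation (\<lambda>\<omega>. (W t \<omega> - W s \<omega>)\<^sup>2) = t - s"
    and expectation_increment_abs: "expectation (\<lambda>\<omega>. \<bar>W t \<omega> - W s \<omega>\<bar>) \<le> sqrt (t - s)"
    and expectation_increment_cube:
      "expectation (\<lambda>\<omega>. \<bar>W t \<omega> - W s \<omega>\<bar> ^ 3) \<le> 2 * ((t - s) * sqrt (t - s))"
proof -
  let ?D = "\<lambda>\<omega>. W t \<omega> - W s \<omega>"
  have "integrable M (\<lambda>\<omega>. (?D \<omega>) ^ k) \<and> expectation ?D = 0 \<and> expectation (\<lambda>\<omega>. (?D \<omega>)\<^sup>2) = t - s \<and>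
      expectation (\<lambda>\<omega>. \<bar>?D \<omega>\<bar>) \<le> sqrt (t - s) \<and>
      expectation (\<lambda>\<omega>. \<bar>?D \<omega>\<bar> ^ 3) \<le> 2 * ((t - s) * sqrt (t - s))"
  proof (cases "s = t")
    case True
    then show ?thesis by (cases k) auto
  next
    case False
    define \<sigma> where "\<sigma> = sqrt (t - s)"
    have \<sigma>: "0 < \<sigma>" "\<sigma>\<^sup>2 = t - s" using False st by (auto simp: \<sigma>_def)
    have D: "distributed M lborel ?D (\<lambda>x. ennreal (normal_density 0 \<sigma> x))"
      using brownian False st by (simp add: brownian_motion_def \<sigma>_def)
    have E: "expectation (\<lambda>\<omega>. g (?D \<omega>)) = (\<integral>x. normal_density 0 \<sigma> x * g x \<partial>lborel)"
      if "g \<in> borel_measurable borel" for g :: "real \<Rightarrow> real"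
      using distributed_integral[OF D, of g] that by simp
    \<comment> \<open>The odd absolute moments of a Gaussian carry the factor \<open>sqrt (2 / pi)\<close>.\<close>
    have "sqrt (2 / pi) \<le> 1" using pi_gt3 by simp
    then have pi: "\<sigma> ^ n * sqrt (2 / pi) \<le> \<sigma> ^ n" for n
      using \<sigma>(1) by (intro mult_left_le) auto
    have "integrable M (\<lambda>\<omega>. (?D \<omega>) ^ k)"
      using distributed_integrable[OF D, of "\<lambda>x. x ^ k"] integrable_normal_moment[OF \<sigma>(1), of 0 k] by simp
    moreover have "expectation ?D = 0"
      using E[of "\<lambda>x. x"] integral_normal_moment_odd[OF \<sigma>(1), of 0 0] by simp
    moreover have "expectation (\<lambda>\<omega>. (?D \<omega>)\<^sup>2) = t - s"
      using E[of "\<lambda>x. x\<^sup>2"] integral_normal_moment_even[OF \<sigma>(1), of 0 1] \<sigma>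
      by (simp add: fact_numeral)
    moreover have "expectation (\<lambda>\<omega>. \<bar>?D \<omega>\<bar>) \<le> sqrt (t - s)"
      using E[of "\<lambda>x. \<bar>x\<bar>"] integral_normal_moment_abs_odd[OF \<sigma>(1), of 0 0] pi[of 1]
      by (simp add: \<sigma>_def)
    moreover have "expectation (\<lambda>\<omega>. \<bar>?D \<omega>\<bar> ^ 3) \<le> 2 * ((t - s) * sqrt (t - s))"
    proof -
      have "(2 * 1 + 1 :: nat) = 3" by simp
      then have "expectation (\<lambda>\<omega>. \<bar>?D \<omega>\<bar> ^ 3) = 2 * (\<sigma> ^ 3 * sqrt (2 / pi))"
        using E[of "\<lambda>x. \<bar>x\<bar> ^ 3"] integral_normal_moment_abs_odd[OF \<sigma>(1), of 0 1] by simp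
      also have "\<dots> \<le> 2 * \<sigma> ^ 3" using pi[of 3] by simp
      also have "\<sigma> ^ 3 = (t - s) * sqrt (t - s)"
        using \<sigma>(2) by (simp add: \<sigma>_def power3_eq_cube power2_eq_square)
      finally show ?thesis by simp
    qed
    ultimately show ?thesis by simp
  qed
  then show "integrable M (\<lambda>\<omega>. (?D \<omega>) ^ k)" "expectation ?D = 0" "expectation (\<lambda>\<omega>. (?D \<omega>)\<^sup>2) = t - s"
    "expectation (\<lambda>\<omega>. \<bar>?D \<omega>\<bar>) \<le> sqrt (t - s)"
    "expectation (\<lambda>\<omega>. \<bar>?D \<omega>\<bar> ^ 3) \<le> 2 * ((t - s) * sqrt (t - s))" by blast+
qed

lemma integrable_bounded:
  fixes Z :: "'a \<Rightarrow> real"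
  assumes "Z \<in> borel_measurable M" "\<And>\<omega>. \<omega> \<in> space M \<Longrightarrow> \<bar>Z \<omega>\<bar> \<le> C"
  shows "integrable M Z"
  using assms by (intro integrable_const_bound[where B = C]) auto

section \<open>The Ito formula in expectation for simple integrands\<close>

text \<open>
  With \<open>D = W s' - W s\<close>, Taylor's formula gives
  \<open>f (X s') = f (X s) + f' (X s) \<xi> D + f'' (X s) \<xi>\<^sup>2 D\<^sup>2 / 2 + O(\<bar>D\<bar>\<^sup>3)\<close>. The coefficients of \<open>D\<close> and
  \<open>D\<^sup>2\<close> are known at time \<open>s\<close>, so by independence the linear term has mean 0 and \<open>D\<^sup>2\<close> may be
  replaced by \<open>s' - s\<close>, while \<open>E \<bar>D\<bar>\<^sup>3\<close> is of order \<open>(s' - s) * sqrt (s' - s)\<close>. Hence \<open>E f(X s)\<close>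
  satisfies the increment estimate of \<open>FTC_of_increment_estimate\<close>.
\<close>

lemma ito_expectation_constant_height:
  assumes f: "bounded_C3 f f' f'' f''' B"
    and ab: "0 \<le> a" "a \<le> b"
    and \<xi>: "\<xi> \<in> borel_measurable (F a)" "\<And>\<omega>. \<omega> \<in> space M \<Longrightarrow> \<bar>\<xi> \<omega>\<bar> \<le> C"
    and X: "\<And>s. s \<in> {a..b} \<Longrightarrow> X s \<in> borel_measurable (F s)"
    and X_eq: "\<And>s \<omega>. s \<in> {a..b} \<Longrightarrow> \<omega> \<in> space M \<Longrightarrow> X s \<omega> = X a \<omega> + \<xi> \<omega> * (W s \<omega> - W a \<omega>)"
  shows "has_bochner_integral lborel
           (\<lambda>s. indicator {a..b} s * expectation (\<lambda>\<omega>. f'' (X s \<omega>) * (\<xi> \<omega>)\<^sup>2 / 2))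
           (expectation (\<lambda>\<omega>. f (X b \<omega>)) - expectation (\<lambda>\<omega>. f (X a \<omega>)))"
proof -
  interpret bounded_C3 f f' f'' f''' B by fact
  have C: "0 \<le> C" using \<xi>(2) not_empty by (metis abs_ge_zero equals0I order_trans)
  have \<xi>M [measurable]: "\<xi> \<in> borel_measurable M" using \<xi>(1) ab(1) by (rule measurable_filtration_M[rotated])
  have \<xi>2: "\<bar>(\<xi> \<omega>)\<^sup>2\<bar> \<le> C\<^sup>2" if "\<omega> \<in> space M" for \<omega>
    using \<xi>(2)[OF that] by (simp add: abs_le_square_iff[symmetric])
  have step: "X s' \<omega> = X s \<omega> + \<xi> \<omega> * (W s' \<omega> - W s \<omega>)"
    if "s \<in> {a..b}" "s' \<in> {a..b}" "\<omega> \<in> space M" for s s' \<omega>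
    using X_eq[of s \<omega>] X_eq[of s' \<omega>] that by (simp add: algebra_simps)
  show ?thesis
  proof (rule FTC_of_increment_estimate[where c = "2 * (B * C ^ 3)"])
    fix s s' assume ss: "a \<le> s" "s \<le> s'" "s' \<le> b"
    let ?D = "\<lambda>\<omega>. W s' \<omega> - W s \<omega>"
    have s0: "0 \<le> s" "0 \<le> s'" using ss ab by auto
    note mom = increment_moments[OF s0(1) ss(2)]
    have XF: "X s \<in> borel_measurable (F s)" using X ss by simp
    have XM [measurable]: "X s \<in> borel_measurable M" "X s' \<in> borel_measurable M"
      using measurable_filtration_M[OF s0(1) X] measurable_filtration_M[OF s0(2) X] ss by auto
    have \<xi>F: "\<xi> \<in> borel_measurable (F s)" using measurable_filtration_mono[OF ab(1) ss(1) \<xi>(1)] .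
    have D [measurable]: "?D \<in> borel_measurable M"
      using s0 by (rule measurable_increment)
    have iD: "integrable M (\<lambda>\<omega>. \<bar>?D \<omega>\<bar>)" "integrable M (\<lambda>\<omega>. \<bar>?D \<omega>\<bar> ^ 3)"
      using integrable_abs[OF mom(1)[of 1]] integrable_abs[OF mom(1)[of 3]] by (simp_all add: power_abs)
    have i0: "integrable M (\<lambda>\<omega>. f (X s \<omega>))" "integrable M (\<lambda>\<omega>. f (X s' \<omega>))"
      by (auto intro!: integrable_bounded[where C = B] bound0)
    have i2: "integrable M (\<lambda>\<omega>. f'' (X r \<omega>) * (\<xi> \<omega>)\<^sup>2 / 2)" if "r = s \<or> r = s'" for r
    proof (rule integrable_bounded[where C = "B * C\<^sup>2"])
      show "(\<lambda>\<omega>. f'' (X r \<omega>) * (\<xi> \<omega>)\<^sup>2 / 2) \<in> borel_measurable M" using that by auto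
      fix \<omega> assume "\<omega> \<in> space M"
      have "\<bar>f'' (X r \<omega>)\<bar> * \<bar>(\<xi> \<omega>)\<^sup>2\<bar> \<le> B * C\<^sup>2"
        using \<open>\<omega> \<in> space M\<close> by (intro mult_mono bound2 \<xi>2) (auto simp: B_nonneg)
      moreover have "0 \<le> \<bar>f'' (X r \<omega>)\<bar> * \<bar>(\<xi> \<omega>)\<^sup>2\<bar>" by simp
      ultimately show "\<bar>f'' (X r \<omega>) * (\<xi> \<omega>)\<^sup>2 / 2\<bar> \<le> B * C\<^sup>2"
        unfolding abs_mult abs_divide abs_numeral by linarith
    qed
    define Z1 where "Z1 \<omega> = f' (X s \<omega>) * \<xi> \<omega>" for \<omega>
    define Z2 where "Z2 \<omega> = f'' (X s \<omega>) * (\<xi> \<omega>)\<^sup>2 / 2" for \<omega>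
    have Z: "Z1 \<in> borel_measurable (F s)" "Z2 \<in> borel_measurable (F s)"
      unfolding Z1_def Z2_def using XF \<xi>F by measurable
    have iZ1: "integrable M Z1"
      unfolding Z1_def
    proof (rule integrable_bounded[where C = "B * C"])
      fix \<omega> assume "\<omega> \<in> space M"
      then show "\<bar>f' (X s \<omega>) * \<xi> \<omega>\<bar> \<le> B * C"
        unfolding abs_mult by (intro mult_mono bound1 \<xi>(2)) (auto simp: B_nonneg)
    qed measurable
    have iZ2: "integrable M Z2" unfolding Z2_def using i2 by simp
    have m1: "integrable M (\<lambda>\<omega>. Z1 \<omega> * ?D \<omega>) \<and> expectation (\<lambda>\<omega>. Z1 \<omega> * ?D \<omega>) = 0"
    proof (cases "s = s'")
      case False
      then show ?thesis
        using expectation_mult_increment[of s s' Z1 "\<lambda>x. x"] Z(1) iZ1 mom(1)[of 1] mom(2) s0 ss by simp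
    qed simp
    have m2: "integrable M (\<lambda>\<omega>. Z2 \<omega> * ((?D \<omega>)\<^sup>2 - (s' - s))) \<and>
        expectation (\<lambda>\<omega>. Z2 \<omega> * ((?D \<omega>)\<^sup>2 - (s' - s))) = 0"
    proof (cases "s = s'")
      case False
      then show ?thesis
        using expectation_mult_increment[of s s' Z2 "\<lambda>x. x\<^sup>2 - (s' - s)"] Z(2) iZ2 mom(1)[of 2] mom(3) s0 ss
        by (simp add: prob_space)
    qed simp
    \<comment> \<open>The Taylor remainder; splitting \<open>D\<^sup>2\<close> into \<open>D\<^sup>2 - (s' - s)\<close> and \<open>s' - s\<close> isolates the
        centred part.\<close>
    define R where "R \<omega> = f (X s' \<omega>) - f (X s \<omega>) - Z1 \<omega> * ?D \<omega> - Z2 \<omega> * (?D \<omega>)\<^sup>2" for \<omega>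
    have R_eq: "R \<omega> = f (X s' \<omega>) - f (X s \<omega>) - Z1 \<omega> * ?D \<omega> - Z2 \<omega> * ((?D \<omega>)\<^sup>2 - (s' - s))
        - (s' - s) * Z2 \<omega>" for \<omega>
      by (simp add: R_def algebra_simps)
    have iR: "integrable M R" unfolding R_eq
      by (intro Bochner_Integration.integrable_diff integrable_mult_right i0 iZ2 m1[THEN conjunct1]
          m2[THEN conjunct1])
    have "expectation R = expectation (\<lambda>\<omega>. f (X s' \<omega>)) - expectation (\<lambda>\<omega>. f (X s \<omega>))
        - (s' - s) * expectation Z2"
      unfolding R_eq using i0 iZ2 m1 m2 by simp
    moreover have "\<bar>expectation R\<bar> \<le> 2 * (B * C ^ 3) * ((s' - s) * sqrt (s' - s))"
    proof -
      have "\<bar>R \<omega>\<bar> \<le> B * C ^ 3 * \<bar>?D \<omega>\<bar> ^ 3" if \<omega>: "\<omega> \<in> space M" for \<omega>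
      proof -
        have "X s' \<omega> = X s \<omega> + \<xi> \<omega> * ?D \<omega>" using step[of s s' \<omega>] ss \<omega> by simp
        then have "R \<omega> = f (X s \<omega> + \<xi> \<omega> * ?D \<omega>) - f (X s \<omega>) - f' (X s \<omega>) * (\<xi> \<omega> * ?D \<omega>)
            - f'' (X s \<omega>) * (\<xi> \<omega> * ?D \<omega>)\<^sup>2 / 2"
          by (simp only: R_def Z1_def Z2_def power_mult_distrib) (simp add: mult.assoc)
        then have "\<bar>R \<omega>\<bar> \<le> B * \<bar>\<xi> \<omega> * ?D \<omega>\<bar> ^ 3"
          using taylor[of "X s \<omega>" "\<xi> \<omega> * ?D \<omega>"] by simp
        also have "\<dots> \<le> B * (C * \<bar>?D \<omega>\<bar>) ^ 3"
          unfolding abs_mult using \<xi>(2)[OF \<omega>]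
          by (intro mult_left_mono power_mono mult_right_mono) (auto simp: B_nonneg)
        finally show ?thesis by (simp add: power_mult_distrib algebra_simps)
      qed
      then have "\<bar>expectation R\<bar> \<le> expectation (\<lambda>\<omega>. B * C ^ 3 * \<bar>?D \<omega>\<bar> ^ 3)"
        using abs_integral_le[of M R "\<lambda>\<omega>. B * C ^ 3 * \<bar>?D \<omega>\<bar> ^ 3"] iR iD by simp
      also have "\<dots> \<le> B * C ^ 3 * (2 * ((s' - s) * sqrt (s' - s)))"
        using mom(5) B_nonneg C by (auto intro!: mult_left_mono)
      finally show ?thesis by simp
    qed
    ultimately show "\<bar>expectation (\<lambda>\<omega>. f (X s' \<omega>)) - expectation (\<lambda>\<omega>. f (X s \<omega>)) -
        (s' - s) * expectation (\<lambda>\<omega>. f'' (X s \<omega>) * (\<xi> \<omega>)\<^sup>2 / 2)\<bar>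
        \<le> 2 * (B * C ^ 3) * ((s' - s) * sqrt (s' - s))"
      by (simp add: Z2_def[abs_def])
    have "\<bar>f'' (X s' \<omega>) * (\<xi> \<omega>)\<^sup>2 / 2 - f'' (X s \<omega>) * (\<xi> \<omega>)\<^sup>2 / 2\<bar> \<le> 2 * (B * C ^ 3) * \<bar>?D \<omega>\<bar>"
      if \<omega>: "\<omega> \<in> space M" for \<omega>
    proof -
      have "\<bar>f'' (X s' \<omega>) * (\<xi> \<omega>)\<^sup>2 - f'' (X s \<omega>) * (\<xi> \<omega>)\<^sup>2\<bar>
          = \<bar>f'' (X s' \<omega>) - f'' (X s \<omega>)\<bar> * \<bar>(\<xi> \<omega>)\<^sup>2\<bar>"
        by (simp only: abs_mult[symmetric] left_diff_distrib)
      also have "\<dots> \<le> (B * (C * \<bar>?D \<omega>\<bar>)) * C\<^sup>2"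
      proof (intro mult_mono \<xi>2 \<omega>)
        have "\<bar>f'' (X s' \<omega>) - f'' (X s \<omega>)\<bar> \<le> B * \<bar>\<xi> \<omega> * ?D \<omega>\<bar>"
          using lipschitz2[of "X s' \<omega>" "X s \<omega>"] step[of s s' \<omega>] ss \<omega> by simp
        also have "\<dots> \<le> B * (C * \<bar>?D \<omega>\<bar>)"
          unfolding abs_mult using \<xi>(2)[OF \<omega>]
          by (intro mult_left_mono mult_right_mono) (auto simp: B_nonneg)
        finally show "\<bar>f'' (X s' \<omega>) - f'' (X s \<omega>)\<bar> \<le> B * (C * \<bar>?D \<omega>\<bar>)" .
      qed (auto simp: B_nonneg C)
      also have "\<dots> = B * C ^ 3 * \<bar>?D \<omega>\<bar>" by (simp add: power2_eq_square power3_eq_cube)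
      finally have *: "\<bar>f'' (X s' \<omega>) * (\<xi> \<omega>)\<^sup>2 - f'' (X s \<omega>) * (\<xi> \<omega>)\<^sup>2\<bar> \<le> B * C ^ 3 * \<bar>?D \<omega>\<bar>" .
      have "\<bar>f'' (X s' \<omega>) * (\<xi> \<omega>)\<^sup>2 / 2 - f'' (X s \<omega>) * (\<xi> \<omega>)\<^sup>2 / 2\<bar>
          = \<bar>f'' (X s' \<omega>) * (\<xi> \<omega>)\<^sup>2 - f'' (X s \<omega>) * (\<xi> \<omega>)\<^sup>2\<bar> / 2"
        by (simp only: diff_divide_distrib[symmetric] abs_divide abs_numeral)
      with * show ?thesis by linarith
    qed
    then have "\<bar>expectation (\<lambda>\<omega>. f'' (X s' \<omega>) * (\<xi> \<omega>)\<^sup>2 / 2 - f'' (X s \<omega>) * (\<xi> \<omega>)\<^sup>2 / 2)\<bar>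
        \<le> expectation (\<lambda>\<omega>. 2 * (B * C ^ 3) * \<bar>?D \<omega>\<bar>)"
      using abs_integral_le[of M "\<lambda>\<omega>. f'' (X s' \<omega>) * (\<xi> \<omega>)\<^sup>2 / 2 - f'' (X s \<omega>) * (\<xi> \<omega>)\<^sup>2 / 2"
          "\<lambda>\<omega>. 2 * (B * C ^ 3) * \<bar>?D \<omega>\<bar>"] i2 iD by simp
    also have "\<dots> \<le> 2 * (B * C ^ 3) * sqrt (s' - s)"
      using mom(4) B_nonneg C by (auto intro!: mult_left_mono)
    finally show "\<bar>expectation (\<lambda>\<omega>. f'' (X s' \<omega>) * (\<xi> \<omega>)\<^sup>2 / 2) - expectation (\<lambda>\<omega>. f'' (X s \<omega>) * (\<xi> \<omega>)\<^sup>2 / 2)\<bar>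
        \<le> 2 * (B * C ^ 3) * sqrt (s' - s)"
      using i2 by simp
  qed (rule ab)
qed

end

text \<open>
  On each interval of the partition, cut off at \<open>t\<close>, the height is constant and the previous lemma
  applies; the boundary terms telescope. At a time \<open>s\<close> at most one interval is active, so the
  sum of the drift terms is the drift term of the simple process.
\<close>

lemma (in brownian_space) ito_expectation_simple_process:
  assumes f: "bounded_C3 f f' f'' f''' B"
    and data: "simple_process_data T M F n \<tau> \<xi>"
    and Y0: "Y0 \<in> borel_measurable (F 0)"
    and t: "t \<in> {0..T}"
  shows "has_bochner_integral lborel
           (\<lambda>s. indicator {0..t} s *
              expectation (\<lambda>\<omega>. f'' (Y0 \<omega> + simple_integral W n \<tau> \<xi> s \<omega>) * (simple_process n \<tau> \<xi> s \<omega>)\<^sup>2 / 2))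
           (expectation (\<lambda>\<omega>. f (Y0 \<omega> + simple_integral W n \<tau> \<xi> t \<omega>)) - expectation (\<lambda>\<omega>. f (Y0 \<omega>)))"
proof -
  define X where "X s \<omega> = Y0 \<omega> + simple_integral W n \<tau> \<xi> s \<omega>" for s \<omega>
  obtain C where C: "\<And>i \<omega>. i < n \<Longrightarrow> \<omega> \<in> space M \<Longrightarrow> \<bar>\<xi> i \<omega>\<bar> \<le> C"
    using data unfolding simple_process_data_def by blast
  have \<tau>: "0 \<le> \<tau> i" "\<tau> i \<le> T" if "i \<le> n" for i
    using data that by (auto simp: simple_process_data_def)
  have \<xi>: "\<xi> i \<in> borel_measurable (F (\<tau> i))" if "i < n" for i
    using data that by (auto simp: simple_process_data_def)
  have \<tau>_mono: "\<tau> i \<le> \<tau> j" if "i \<le> j" "j \<le> n" for i j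
    using that
  proof (induction j rule: dec_induct)
    case (step m)
    then have "\<tau> m \<le> \<tau> (Suc m)" using data by (auto simp: simple_process_data_def)
    with step show ?case by simp
  qed simp
  have X_meas: "X s \<in> borel_measurable (F s)" if s: "0 \<le> s" for s
  proof -
    have "(\<lambda>\<omega>. \<xi> i \<omega> * (W (min s (\<tau> (Suc i))) \<omega> - W (min s (\<tau> i)) \<omega>)) \<in> borel_measurable (F s)"
      if i: "i < n" for i
    proof (cases "\<tau> i \<le> s")
      case True
      have W: "W (min s (\<tau> j)) \<in> borel_measurable (F s)" if "j \<le> n" for j
        using s \<tau>[OF that]
        by (intro measurable_filtration_mono[OF _ _ measurable_brownian]) auto
      have "\<xi> i \<in> borel_measurable (F s)"
        using \<tau>(1)[of i] i True \<xi> by (intro measurable_filtration_mono[of "\<tau> i" s]) auto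
      then show ?thesis using W[of i] W[of "Suc i"] i by (intro borel_measurable_times borel_measurable_diff) auto
    next
      case False
      then have "min s (\<tau> (Suc i)) = s" "min s (\<tau> i) = s"
        using \<tau>_mono[of i "Suc i"] i by auto
      then show ?thesis by simp
    qed
    then show ?thesis
      unfolding X_def[abs_def] simple_integral_def
      using measurable_filtration_mono[OF order_refl s Y0]
      by (intro borel_measurable_add borel_measurable_sum) auto
  qed
  have X_step: "X s \<omega> = X (\<tau> i) \<omega> + \<xi> i \<omega> * (W s \<omega> - W (\<tau> i) \<omega>)"
    if i: "i < n" and s: "s \<in> {\<tau> i..\<tau> (Suc i)}" for i s \<omega>
  proof -
    let ?term = "\<lambda>r j. \<xi> j \<omega> * (W (min r (\<tau> (Suc j))) \<omega> - W (min r (\<tau> j)) \<omega>)"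
    have "?term s j - ?term (\<tau> i) j = (if j = i then \<xi> i \<omega> * (W s \<omega> - W (\<tau> i) \<omega>) else 0)"
      if j: "j < n" for j
    proof -
      consider "j < i" | "j = i" | "i < j" by linarith
      then show ?thesis
      proof cases
        case 1
        then have "\<tau> j \<le> \<tau> i" "\<tau> (Suc j) \<le> \<tau> i" using \<tau>_mono i by auto
        then have "min s (\<tau> (Suc j)) = \<tau> (Suc j)" "min s (\<tau> j) = \<tau> j"
            "min (\<tau> i) (\<tau> (Suc j)) = \<tau> (Suc j)" "min (\<tau> i) (\<tau> j) = \<tau> j"
          using s by auto
        then show ?thesis using 1 by simp
      next
        case 2
        have "min s (\<tau> (Suc i)) = s" "min s (\<tau> i) = \<tau> i" "min (\<tau> i) (\<tau> (Suc i)) = \<tau> i" using s by auto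
        then show ?thesis using 2 by simp
      next
        case 3
        then have "\<tau> (Suc i) \<le> \<tau> j" "\<tau> (Suc i) \<le> \<tau> (Suc j)" "\<tau> i \<le> \<tau> (Suc i)" using \<tau>_mono j by auto
        then have "min s (\<tau> (Suc j)) = s" "min s (\<tau> j) = s" "min (\<tau> i) (\<tau> (Suc j)) = \<tau> i" "min (\<tau> i) (\<tau> j) = \<tau> i"
          using s by auto
        then show ?thesis using 3 by simp
      qed
    qed
    then have "X s \<omega> - X (\<tau> i) \<omega> = (\<Sum>j<n. if j = i then \<xi> i \<omega> * (W s \<omega> - W (\<tau> i) \<omega>) else 0)"
      unfolding X_def simple_integral_def add_diff_cancel_left sum_subtractf[symmetric]
      by (intro sum.cong) auto
    also have "\<dots> = \<xi> i \<omega> * (W s \<omega> - W (\<tau> i) \<omega>)" using i by simp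
    finally show ?thesis by simp
  qed
  \<comment> \<open>The cut-off partition. If \<open>t < \<tau> i\<close>, the height \<open>\<xi> i\<close> need not be known at time \<open>t\<close>, but then
      the interval from \<open>q i\<close> to \<open>q (Suc i)\<close> is degenerate.\<close>
  define q where "q i = min t (\<tau> i)" for i
  define E where "E i s = expectation (\<lambda>\<omega>. f'' (X s \<omega>) * (\<xi> i \<omega>)\<^sup>2 / 2)" for i s
  have piece: "has_bochner_integral lborel (\<lambda>s. indicator {\<tau> i<..\<tau> (Suc i)} s * (indicator {0..t} s * E i s))
      (expectation (\<lambda>\<omega>. f (X (q (Suc i)) \<omega>)) - expectation (\<lambda>\<omega>. f (X (q i) \<omega>)))"
    if i: "i < n" for i
  proof (cases "\<tau> i \<le> t")
    case True
    have qi: "q i = \<tau> i" "q i \<le> q (Suc i)" "q (Suc i) \<le> \<tau> (Suc i)" "0 \<le> q i"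
      using True \<tau>_mono[of i "Suc i"] \<tau>(1)[of i] i by (auto simp: q_def)
    have *: "has_bochner_integral lborel (\<lambda>s. indicator {q i..q (Suc i)} s * E i s)
        (expectation (\<lambda>\<omega>. f (X (q (Suc i)) \<omega>)) - expectation (\<lambda>\<omega>. f (X (q i) \<omega>)))"
      unfolding E_def
    proof (rule ito_expectation_constant_height[OF f, where C = C])
      show "X s \<in> borel_measurable (F s)" if "s \<in> {q i..q (Suc i)}" for s
        using that qi by (intro X_meas) auto
      show "X s \<omega> = X (q i) \<omega> + \<xi> i \<omega> * (W s \<omega> - W (q i) \<omega>)" if "s \<in> {q i..q (Suc i)}" for s \<omega>
        using X_step[OF i, of s \<omega>] that qi by auto
    qed (use qi \<xi>[OF i] C[OF i] in auto)
    \<comment> \<open>Simple processes live on half-open intervals, the fundamental theorem of calculus on closed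
        ones; they differ by the null set of the left end point.\<close>
    have "(\<lambda>s. indicator {\<tau> i<..\<tau> (Suc i)} s * (indicator {0..t} s * E i s)) =
        (\<lambda>s. indicator {q i<..} s * (indicator {q i..q (Suc i)} s * E i s))"
      using \<tau>(1)[of i] i by (auto simp: qi(1) fun_eq_iff q_def split: split_indicator)
    moreover have "has_bochner_integral lborel
        (\<lambda>s. indicator {q i<..} s * (indicator {q i..q (Suc i)} s * E i s))
        (expectation (\<lambda>\<omega>. f (X (q (Suc i)) \<omega>)) - expectation (\<lambda>\<omega>. f (X (q i) \<omega>)))"
    proof (rule has_bochner_integralI_AE[OF *])
      have "(\<lambda>s. indicator {q i..q (Suc i)} s * E i s) \<in> borel_measurable lborel"
        using * by (rule borel_measurable_has_bochner_integral)
      then show "(\<lambda>s. indicator {q i<..} s * (indicator {q i..q (Suc i)} s * E i s)) \<in> borel_measurable lborel"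
        by (rule borel_measurable_times[rotated]) simp
      show "AE s in lborel. indicator {q i..q (Suc i)} s * E i s =
          indicator {q i<..} s * (indicator {q i..q (Suc i)} s * E i s)"
        using AE_lborel_singleton[of "q i"] by eventually_elim (auto split: split_indicator)
    qed
    ultimately show ?thesis by simp
  next
    case False
    then have "q (Suc i) = q i" using \<tau>_mono[of i "Suc i"] i by (auto simp: q_def)
    moreover have "(\<lambda>s. indicator {\<tau> i<..\<tau> (Suc i)} s * (indicator {0..t} s * E i s)) = (\<lambda>_. 0)"
      using False by (auto simp: fun_eq_iff split: split_indicator)
    ultimately show ?thesis by (simp add: has_bochner_integral_zero)
  qed
  have "has_bochner_integral lborel
      (\<lambda>s. \<Sum>i<n. indicator {\<tau> i<..\<tau> (Suc i)} s * (indicator {0..t} s * E i s))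
      (\<Sum>i<n. expectation (\<lambda>\<omega>. f (X (q (Suc i)) \<omega>)) - expectation (\<lambda>\<omega>. f (X (q i) \<omega>)))"
    by (intro has_bochner_integral_sum piece) simp
  moreover have "(\<Sum>i<n. expectation (\<lambda>\<omega>. f (X (q (Suc i)) \<omega>)) - expectation (\<lambda>\<omega>. f (X (q i) \<omega>))) =
      expectation (\<lambda>\<omega>. f (X t \<omega>)) - expectation (\<lambda>\<omega>. f (Y0 \<omega>))"
  proof -
    have "min (q n) (\<tau> j) = min t (\<tau> j)" if "j \<le> n" for j
      using \<tau>_mono[OF that] by (auto simp: q_def)
    then have "X (q n) = X t" by (simp add: fun_eq_iff X_def simple_integral_def)
    moreover have "min (q 0) (\<tau> j) = q 0" if "j \<le> n" for j
      using \<tau>_mono[OF _ that, of 0] by (auto simp: q_def)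
    then have "X (q 0) = Y0" by (simp add: fun_eq_iff X_def simple_integral_def)
    ultimately show ?thesis
      using sum_lessThan_telescope[of "\<lambda>i. expectation (\<lambda>\<omega>. f (X (q i) \<omega>))" n] by simp
  qed
  moreover have "(\<Sum>i<n. indicator {\<tau> i<..\<tau> (Suc i)} s * (indicator {0..t} s * E i s)) =
      indicator {0..t} s * expectation (\<lambda>\<omega>. f'' (X s \<omega>) * (simple_process n \<tau> \<xi> s \<omega>)\<^sup>2 / 2)" for s
  proof (cases "\<exists>i<n. s \<in> {\<tau> i<..\<tau> (Suc i)}")
    case True
    then obtain i where i: "i < n" "s \<in> {\<tau> i<..\<tau> (Suc i)}" by blast
    have ind: "indicator {\<tau> j<..\<tau> (Suc j)} s = (if j = i then 1 else 0 :: real)" if "j < n" for j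
    proof -
      consider "j < i" | "j = i" | "i < j" by linarith
      then show ?thesis
      proof cases
        case 1 then show ?thesis using \<tau>_mono[of "Suc j" i] i by auto
      next
        case 3 then show ?thesis using \<tau>_mono[of "Suc i" j] that i by auto
      qed (use i in auto)
    qed
    have pick: "(\<Sum>j<n. indicator {\<tau> j<..\<tau> (Suc j)} s * c j) = c i" for c :: "nat \<Rightarrow> real"
    proof -
      have "(\<Sum>j<n. indicator {\<tau> j<..\<tau> (Suc j)} s * c j) = (\<Sum>j<n. if j = i then c i else 0)"
        by (intro sum.cong) (auto simp: ind)
      then show ?thesis using i by simp
    qed
    have "simple_process n \<tau> \<xi> s \<omega> = \<xi> i \<omega>" for \<omega>
      unfolding simple_process_def mult.commute[of "\<xi> _ \<omega>"] by (rule pick)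
    then show ?thesis by (simp only: pick E_def)
  next
    case False
    then have "indicator {\<tau> j<..\<tau> (Suc j)} s = (0 :: real)" if "j < n" for j
      using that by (auto split: split_indicator)
    then show ?thesis by (simp add: simple_process_def)
  qed
  ultimately show ?thesis by (simp add: X_def)
qed

section \<open>Passage to the limit\<close>

lemma (in prob_space) expectation_lipschitz_tendsto:
  fixes X :: "nat \<Rightarrow> 'a \<Rightarrow> real" and h :: "real \<Rightarrow> real"
  assumes [measurable]: "\<And>k. X k \<in> borel_measurable M" "Y \<in> borel_measurable M" "h \<in> borel_measurable borel"
    and lim: "(\<lambda>k. \<integral>\<^sup>+\<omega>. ennreal ((X k \<omega> - Y \<omega>)\<^sup>2) \<partial>M) \<longlonglongrightarrow> 0"
    and lip: "\<And>x y. \<bar>h y - h x\<bar> \<le> L * \<bar>y - x\<bar>" and bdd: "\<And>x. \<bar>h x\<bar> \<le> L"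
  shows "(\<lambda>k. expectation (\<lambda>\<omega>. \<bar>h (X k \<omega>) - h (Y \<omega>)\<bar>)) \<longlonglongrightarrow> 0"
proof -
  have L: "0 \<le> L" using bdd[of 0] by linarith
  have "(\<lambda>k. \<integral>\<^sup>+\<omega>. ennreal \<bar>X k \<omega> - Y \<omega>\<bar> \<partial>M) \<longlonglongrightarrow> 0"
    by (rule nn_integral_abs_tendsto_0_of_square[OF _ _ lim]) (auto simp: emeasure_space_1)
  from ennreal_tendsto_cmult[OF _ this, of "ennreal L"]
  have "(\<lambda>k. ennreal L * (\<integral>\<^sup>+\<omega>. ennreal \<bar>X k \<omega> - Y \<omega>\<bar> \<partial>M)) \<longlonglongrightarrow> 0" by simp
  moreover have "ennreal (expectation (\<lambda>\<omega>. \<bar>h (X k \<omega>) - h (Y \<omega>)\<bar>))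
      \<le> ennreal L * (\<integral>\<^sup>+\<omega>. ennreal \<bar>X k \<omega> - Y \<omega>\<bar> \<partial>M)" for k
  proof -
    have "\<bar>\<bar>h x - h y\<bar>\<bar> \<le> 2 * L" for x y using bdd[of x] bdd[of y] by linarith
    then have "integrable M (\<lambda>\<omega>. \<bar>h (X k \<omega>) - h (Y \<omega>)\<bar>)"
      by (intro integrable_const_bound[where B = "2 * L"]) auto
    then have "ennreal (expectation (\<lambda>\<omega>. \<bar>h (X k \<omega>) - h (Y \<omega>)\<bar>)) = (\<integral>\<^sup>+\<omega>. ennreal \<bar>h (X k \<omega>) - h (Y \<omega>)\<bar> \<partial>M)"
      by (simp add: nn_integral_eq_integral)
    also have "\<dots> \<le> (\<integral>\<^sup>+\<omega>. ennreal L * ennreal \<bar>X k \<omega> - Y \<omega>\<bar> \<partial>M)"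
      using lip L by (intro nn_integral_mono) (simp add: ennreal_mult[symmetric] ennreal_leI)
    also have "\<dots> = ennreal L * (\<integral>\<^sup>+\<omega>. ennreal \<bar>X k \<omega> - Y \<omega>\<bar> \<partial>M)"
      by (rule nn_integral_cmult) measurable
    finally show ?thesis .
  qed
  ultimately have "(\<lambda>k. ennreal (expectation (\<lambda>\<omega>. \<bar>h (X k \<omega>) - h (Y \<omega>)\<bar>))) \<longlonglongrightarrow> 0"
    by (intro tendsto_sandwich[where f = "\<lambda>_. 0"
          and g = "\<lambda>k. ennreal (expectation (\<lambda>\<omega>. \<bar>h (X k \<omega>) - h (Y \<omega>)\<bar>))",
          OF _ _ tendsto_const] always_eventually allI) auto
  then show ?thesis by (simp add: ennreal_tendsto_0_iff)
qed

lemma tendsto_integral_of_L1: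
  fixes g :: "nat \<Rightarrow> 'b \<Rightarrow> real"
  assumes "\<And>k. integrable N (g k)" "integrable N h"
    and lim: "(\<lambda>k. \<integral>x. \<bar>g k x - h x\<bar> \<partial>N) \<longlonglongrightarrow> 0"
  shows "(\<lambda>k. integral\<^sup>L N (g k)) \<longlonglongrightarrow> integral\<^sup>L N h"
proof -
  have "norm (integral\<^sup>L N (g k) - integral\<^sup>L N h) \<le> (\<integral>x. \<bar>g k x - h x\<bar> \<partial>N)" for k
    using assms(1)[of k] assms(2) integral_abs_bound[of N "\<lambda>x. g k x - h x"] by simp
  then have "(\<lambda>k. integral\<^sup>L N (g k) - integral\<^sup>L N h) \<longlonglongrightarrow> 0"
    by (intro Lim_null_comparison[OF _ lim] always_eventually) auto
  then show ?thesis by (simp add: LIM_zero_iff)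
qed

lemma nn_integral_set_swap:
  fixes h :: "real \<Rightarrow> 'a \<Rightarrow> real" and T :: real
  assumes "sigma_finite_measure M"
    and h: "(\<lambda>(s, \<omega>). h s \<omega>) \<in> borel_measurable (restrict_space lborel {0..T} \<Otimes>\<^sub>M M)"
  shows "(\<integral>\<^sup>+\<omega>. (\<integral>\<^sup>+s\<in>{0..T}. ennreal (h s \<omega>) \<partial>lborel) \<partial>M) =
         (\<integral>\<^sup>+x. ennreal (h (fst x) (snd x)) \<partial>(restrict_space lborel {0..T} \<Otimes>\<^sub>M M))"
proof -
  let ?R = "restrict_space lborel {0..T}"
  interpret M: sigma_finite_measure M by fact
  interpret R: sigma_finite_measure ?R
    by (intro sigma_finite_measure_restrict_space) (auto intro: sigma_finite_lborel)
  interpret P: pair_sigma_finite ?R M ..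
  have "(\<integral>\<^sup>+s\<in>{0..T}. ennreal (h s \<omega>) \<partial>lborel) = (\<integral>\<^sup>+s. ennreal (h s \<omega>) \<partial>?R)" for \<omega>
    by (simp add: nn_integral_restrict_space)
  moreover have "(\<integral>\<^sup>+\<omega>. (\<integral>\<^sup>+s. ennreal (h s \<omega>) \<partial>?R) \<partial>M) =
      (\<integral>\<^sup>+x. ennreal (h (fst x) (snd x)) \<partial>(?R \<Otimes>\<^sub>M M))"
    using P.nn_integral_snd[of "\<lambda>x. ennreal (h (fst x) (snd x))"] h by (simp add: case_prod_unfold)
  ultimately show ?thesis by simp
qed

context brownian_space
begin

lemma progressively_measurable_product:
  assumes "progressively_measurable T F H" "0 \<le> T"
  shows "(\<lambda>(s, \<omega>). H s \<omega>) \<in> borel_measurable (restrict_space lborel {0..T} \<Otimes>\<^sub>M M)"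
proof -
  let ?N = "restrict_space lborel {0..T} \<Otimes>\<^sub>M M"
  have "snd \<in> measurable ?N (F T)"
  proof (rule measurableI)
    have sp: "space (F T) = space M" "sets (F T) \<subseteq> sets M"
      using subalgebra_filtration[OF assms(2)] by (auto simp: subalgebra_def)
    show "snd x \<in> space (F T)" if "x \<in> space ?N" for x
      using that by (auto simp: space_pair_measure sp)
    show "snd -` A \<inter> space ?N \<in> sets ?N" if "A \<in> sets (F T)" for A
      using measurable_sets[OF measurable_snd, of A M] that sp by auto
  qed
  moreover have "fst \<in> measurable ?N (restrict_space borel {0..T})"
    using measurable_fst[of "restrict_space lborel {0..T}" M]
    by (simp add: measurable_cong_sets[OF refl sets_restrict_space_cong[OF sets_lborel]])
  ultimately have "(\<lambda>x. (fst x, snd x)) \<in> measurable ?N (restrict_space borel {0..T} \<Otimes>\<^sub>M F T)"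
    by (rule measurable_Pair[rotated])
  moreover have "(\<lambda>(s, \<omega>). H s \<omega>) \<in> borel_measurable (restrict_space borel {0..T} \<Otimes>\<^sub>M F T)"
    using assms by (simp add: progressively_measurable_def)
  ultimately show ?thesis
    using measurable_compose[of "\<lambda>x. (fst x, snd x)"] by simp
qed

lemma simple_process_measurable_product:
  assumes data: "simple_process_data T M F n \<tau> \<xi>"
  shows "(\<lambda>(s, \<omega>). simple_process n \<tau> \<xi> s \<omega>) \<in> borel_measurable (restrict_space lborel {0..T} \<Otimes>\<^sub>M M)"
proof -
  let ?N = "restrict_space lborel {0..T} \<Otimes>\<^sub>M M"
  have [measurable]: "fst \<in> borel_measurable ?N"
    by (rule measurable_compose[OF measurable_fst]) (simp add: measurable_restrict_space1)
  have \<xi>: "\<xi> i \<in> borel_measurable M" if "i < n" for i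
    using data that by (intro measurable_filtration_M[of "\<tau> i"]) (auto simp: simple_process_data_def)
  have "(\<lambda>x. \<xi> i (snd x)) \<in> borel_measurable ?N" if "i < n" for i
    using measurable_compose[OF measurable_snd \<xi>[OF that]] .
  then show ?thesis
    unfolding simple_process_def case_prod_unfold
    by (intro borel_measurable_sum borel_measurable_times) auto
qed

lemma simple_process_bounded:
  assumes data: "simple_process_data T M F n \<tau> \<xi>"
  obtains C where "\<And>s \<omega>. \<omega> \<in> space M \<Longrightarrow> \<bar>simple_process n \<tau> \<xi> s \<omega>\<bar> \<le> C"
proof -
  obtain C where C: "\<And>i \<omega>. i < n \<Longrightarrow> \<omega> \<in> space M \<Longrightarrow> \<bar>\<xi> i \<omega>\<bar> \<le> C"
    using data unfolding simple_process_data_def by blast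
  have "\<bar>simple_process n \<tau> \<xi> s \<omega>\<bar> \<le> (\<Sum>i<n. C)" if "\<omega> \<in> space M" for s \<omega>
    unfolding simple_process_def
  proof (rule order_trans[OF sum_abs sum_mono])
    fix i assume "i \<in> {..<n}"
    then show "\<bar>\<xi> i \<omega> * indicator {\<tau> i<..\<tau> (Suc i)} s\<bar> \<le> C"
      using C[of i \<omega>] that by (auto split: split_indicator)
  qed
  then show thesis by (rule that)
qed

lemma simple_integral_measurable:
  assumes data: "simple_process_data T M F n \<tau> \<xi>" and s: "0 \<le> s"
  shows "simple_integral W n \<tau> \<xi> s \<in> borel_measurable M"
proof -
  have \<tau>: "0 \<le> \<tau> i" if "i \<le> n" for i using data that by (auto simp: simple_process_data_def)
  have \<xi>: "\<xi> i \<in> borel_measurable M" if "i < n" for i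
    using data that by (intro measurable_filtration_M[of "\<tau> i"]) (auto simp: simple_process_data_def)
  have "(\<lambda>\<omega>. W (min s (\<tau> (Suc i))) \<omega> - W (min s (\<tau> i)) \<omega>) \<in> borel_measurable M" if "i < n" for i
    using \<tau>[of i] \<tau>[of "Suc i"] that s by (intro measurable_increment) auto
  with \<xi> show ?thesis
    unfolding simple_integral_def[abs_def] by (intro borel_measurable_sum borel_measurable_times) auto
qed

text \<open>
  Let \<open>S k\<close> be simple processes approximating \<open>H\<close>, with integrals \<open>X k\<close> started at \<open>Y 0\<close>. The
  previous section gives the claim for \<open>X k\<close>, and it remains to let \<open>k\<close> tend to infinity. The left
  side converges because \<open>f\<close> is Lipschitz and \<open>X k t\<close> tends to \<open>Y t\<close> in \<open>L\<^sup>2\<close>. For the drift,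
  \<open>\<bar>f''(X k) (S k)\<^sup>2 - f''(Y) H\<^sup>2\<bar> \<le> B \<bar>(S k)\<^sup>2 - H\<^sup>2\<bar> + K\<^sup>2 \<bar>f''(X k) - f''(Y)\<bar>\<close>,
  where \<open>K\<close> bounds \<open>H\<close>. The first term tends to 0 in \<open>L\<^sup>1\<close> of the product space. The second one tends
  to 0 in mean at every fixed time and stays below \<open>2 B K\<^sup>2\<close>, so dominated convergence in time
  applies to it.

  The measurability assumption on the drift is easily checked when \<open>Y\<close> has a jointly measurable
  density, since the expectation is then an integral with respect to that density.
\<close>

lemma ito_expectation:
  assumes f: "bounded_C3 f f' f'' f''' B"
    and ito: "has_ito_integral M F W T H I"
    and H_le: "\<And>s \<omega>. s \<in> {0..T} \<Longrightarrow> \<omega> \<in> space M \<Longrightarrow> \<bar>H s \<omega>\<bar> \<le> K"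
    and Y: "\<And>s. s \<in> {0..T} \<Longrightarrow> Y s \<in> borel_measurable M" and Y0: "Y 0 \<in> borel_measurable (F 0)"
    and Y_eq: "\<And>s. s \<in> {0..T} \<Longrightarrow> AE \<omega> in M. Y s \<omega> = Y 0 \<omega> + I s \<omega>"
    and t: "t \<in> {0..T}"
    and drift: "(\<lambda>s. indicator {0..t} s * expectation (\<lambda>\<omega>. f'' (Y s \<omega>) * (H s \<omega>)\<^sup>2 / 2)) \<in> borel_measurable lborel"
  shows "expectation (\<lambda>\<omega>. f (Y t \<omega>)) = expectation (\<lambda>\<omega>. f (Y 0 \<omega>)) +
           (LINT s|lborel. indicator {0..t} s * expectation (\<lambda>\<omega>. f'' (Y s \<omega>) * (H s \<omega>)\<^sup>2 / 2))"
proof -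
  interpret bounded_C3 f f' f'' f''' B by fact
  have T: "0 \<le> T" using t by auto
  obtain \<omega>0 where "\<omega>0 \<in> space M" using not_empty by blast
  then have K: "0 \<le> K" using H_le[of 0] T by force
  from ito obtain n \<tau> \<xi> where
    data: "\<And>k. simple_process_data T M F (n k) (\<tau> k) (\<xi> k)" and
    lim_H: "(\<lambda>k. \<integral>\<^sup>+\<omega>. (\<integral>\<^sup>+s\<in>{0..T}.
        ennreal ((simple_process (n k) (\<tau> k) (\<xi> k) s \<omega> - H s \<omega>)\<^sup>2) \<partial>lborel) \<partial>M) \<longlonglongrightarrow> 0" and
    lim_I: "\<And>s. s \<in> {0..T} \<Longrightarrow>
        (\<lambda>k. \<integral>\<^sup>+\<omega>. ennreal ((simple_integral W (n k) (\<tau> k) (\<xi> k) s \<omega> - I s \<omega>)\<^sup>2) \<partial>M) \<longlonglongrightarrow> 0"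
    unfolding has_ito_integral_def by blast
  define S where "S k s \<omega> = simple_process (n k) (\<tau> k) (\<xi> k) s \<omega>" for k s \<omega>
  define X where "X k s \<omega> = Y 0 \<omega> + simple_integral W (n k) (\<tau> k) (\<xi> k) s \<omega>" for k s \<omega>
  define R where "R = restrict_space lborel {0..T}"
  define N where "N = R \<Otimes>\<^sub>M M"
  have spR: "space R = {0..T}" by (simp add: R_def)
  have spN: "space N = {0..T} \<times> space M" by (simp add: N_def space_pair_measure spR)
  have emR: "emeasure R (space R) = ennreal T" using T by (simp add: R_def emeasure_restrict_space spR[unfolded R_def])
  interpret R: finite_measure R by (rule finite_measureI) (simp add: emR)
  interpret P: pair_sigma_finite R M ..
  interpret N: finite_measure N
    unfolding N_def by (rule finite_measure_pair_measure) unfold_locales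
  have HN: "(\<lambda>(s, \<omega>). H s \<omega>) \<in> borel_measurable N"
    using progressively_measurable_product[OF _ T, of H] ito by (simp add: N_def R_def has_ito_integral_def)
  have SN: "(\<lambda>(s, \<omega>). S k s \<omega>) \<in> borel_measurable N" for k
    using simple_process_measurable_product[OF data[of k]] by (simp add: N_def R_def S_def)
  have HN' [measurable]: "(\<lambda>x. H (fst x) (snd x)) \<in> borel_measurable N"
    using HN by (simp add: case_prod_unfold)
  have SN' [measurable]: "(\<lambda>x. S k (fst x) (snd x)) \<in> borel_measurable N" for k
    using SN[of k] by (simp add: case_prod_unfold)
  have HM: "H s \<in> borel_measurable M" if "s \<in> {0..T}" for s
    using measurable_Pair2[OF HN[unfolded N_def], of s] that by (simp add: spR)
  have SM: "S k s \<in> borel_measurable M" if "s \<in> {0..T}" for k s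
    using measurable_Pair2[OF SN[unfolded N_def], of s] that by (simp add: spR)
  have XM: "X k s \<in> borel_measurable M" if "s \<in> {0..T}" for k s
    unfolding X_def[abs_def] using that Y[of 0] T simple_integral_measurable[OF data, of s k]
    by (intro borel_measurable_add) auto

  \<comment> \<open>The error from replacing \<open>H\<^sup>2\<close> by \<open>(S k)\<^sup>2\<close>; it is small because
      \<open>(S k)\<^sup>2 - H\<^sup>2 = \<delta>\<^sup>2 + 2 H \<delta>\<close> with \<open>\<delta> = S k - H\<close>, and \<open>H\<close> is bounded.\<close>
  define \<alpha> where "\<alpha> k s = expectation (\<lambda>\<omega>. \<bar>(S k s \<omega>)\<^sup>2 - (H s \<omega>)\<^sup>2\<bar>)" for k s
  have S_bdd: "\<exists>C\<ge>0. \<forall>s\<in>{0..T}. \<forall>\<omega>\<in>space M. (S k s \<omega>)\<^sup>2 \<le> C \<and> \<bar>(S k s \<omega>)\<^sup>2 - (H s \<omega>)\<^sup>2\<bar> \<le> C" for k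
  proof -
    obtain C where C: "\<And>s \<omega>. \<omega> \<in> space M \<Longrightarrow> \<bar>S k s \<omega>\<bar> \<le> C"
      using simple_process_bounded[OF data[of k]] unfolding S_def by blast
    have "(S k s \<omega>)\<^sup>2 \<le> C\<^sup>2" if "\<omega> \<in> space M" for s \<omega>
      using C[OF that, of s] by (simp add: abs_le_square_iff[symmetric])
    moreover have "(H s \<omega>)\<^sup>2 \<le> K\<^sup>2" if "s \<in> {0..T}" "\<omega> \<in> space M" for s \<omega>
      using H_le[OF that] by (simp add: abs_le_square_iff[symmetric])
    ultimately have "(S k s \<omega>)\<^sup>2 \<le> C\<^sup>2 + K\<^sup>2 \<and> \<bar>(S k s \<omega>)\<^sup>2 - (H s \<omega>)\<^sup>2\<bar> \<le> C\<^sup>2 + K\<^sup>2"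
      if "s \<in> {0..T}" "\<omega> \<in> space M" for s \<omega>
      using that zero_le_power2[of "S k s \<omega>"] zero_le_power2[of "H s \<omega>"] zero_le_power2[of K]
      by (smt (verit))
    then show ?thesis by (intro exI[of _ "C\<^sup>2 + K\<^sup>2"]) auto
  qed
  have \<alpha>_int: "integrable R (\<alpha> k)" and \<alpha>_lim: "(\<lambda>k. \<integral>s. \<alpha> k s \<partial>R) \<longlonglongrightarrow> 0" for k
  proof -
    define h where "h k x = \<bar>(S k (fst x) (snd x))\<^sup>2 - (H (fst x) (snd x))\<^sup>2\<bar>" for k x
    have hN [measurable]: "h k \<in> borel_measurable N" for k unfolding h_def by measurable
    have h_int: "integrable N (h k)" for k
    proof -
      obtain C where "\<forall>s\<in>{0..T}. \<forall>\<omega>\<in>space M. \<bar>(S k s \<omega>)\<^sup>2 - (H s \<omega>)\<^sup>2\<bar> \<le> C"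
        using S_bdd[of k] by blast
      then show ?thesis
        by (intro N.integrable_const_bound[where B = C]) (auto simp: h_def spN)
    qed
    show "integrable R (\<alpha> k)"
      using P.integrable_fst'[OF h_int[unfolded N_def], of k] by (simp add: h_def \<alpha>_def[abs_def])
    have eq: "(\<integral>s. \<alpha> k s \<partial>R) = integral\<^sup>L N (h k)" for k
      using P.integral_fst'[OF h_int[unfolded N_def], of k] by (simp add: h_def \<alpha>_def N_def)
    define \<delta> where "\<delta> k x = S k (fst x) (snd x) - H (fst x) (snd x)" for k x
    have \<delta>N [measurable]: "\<delta> k \<in> borel_measurable N" for k unfolding \<delta>_def by measurable
    have "(\<lambda>(s, \<omega>). (S k s \<omega> - H s \<omega>)\<^sup>2) \<in> borel_measurable N" for k
      unfolding case_prod_unfold by measurable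
    then have "(\<integral>\<^sup>+\<omega>. (\<integral>\<^sup>+s\<in>{0..T}. ennreal ((S k s \<omega> - H s \<omega>)\<^sup>2) \<partial>lborel) \<partial>M) =
        (\<integral>\<^sup>+x. ennreal ((\<delta> k x)\<^sup>2) \<partial>N)" for k
      using nn_integral_set_swap[of M "\<lambda>s \<omega>. (S k s \<omega> - H s \<omega>)\<^sup>2" T] sigma_finite_measure_axioms
      by (simp add: N_def R_def \<delta>_def)
    then have sq: "(\<lambda>k. \<integral>\<^sup>+x. ennreal ((\<delta> k x)\<^sup>2) \<partial>N) \<longlonglongrightarrow> 0"
      using lim_H by (simp add: S_def)
    then have "(\<lambda>k. \<integral>\<^sup>+x. ennreal \<bar>\<delta> k x\<bar> \<partial>N) \<longlonglongrightarrow> 0"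
      by (intro nn_integral_abs_tendsto_0_of_square) (auto simp: top.not_eq_extremum[symmetric])
    from tendsto_add[OF sq ennreal_tendsto_cmult[OF _ this, of "ennreal (2 * K)"]]
    have "(\<lambda>k. (\<integral>\<^sup>+x. ennreal ((\<delta> k x)\<^sup>2) \<partial>N) + ennreal (2 * K) * (\<integral>\<^sup>+x. ennreal \<bar>\<delta> k x\<bar> \<partial>N)) \<longlonglongrightarrow> 0"
      by simp
    moreover have "ennreal (integral\<^sup>L N (h k)) \<le>
        (\<integral>\<^sup>+x. ennreal ((\<delta> k x)\<^sup>2) \<partial>N) + ennreal (2 * K) * (\<integral>\<^sup>+x. ennreal \<bar>\<delta> k x\<bar> \<partial>N)" for k
    proof -
      have "h k x \<le> (\<delta> k x)\<^sup>2 + 2 * K * \<bar>\<delta> k x\<bar>" if "x \<in> space N" for x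
      proof -
        have "(S k (fst x) (snd x))\<^sup>2 - (H (fst x) (snd x))\<^sup>2 = (\<delta> k x)\<^sup>2 + 2 * H (fst x) (snd x) * \<delta> k x"
          by (simp add: \<delta>_def power2_eq_square algebra_simps)
        also have "\<bar>\<dots>\<bar> \<le> (\<delta> k x)\<^sup>2 + \<bar>2 * H (fst x) (snd x) * \<delta> k x\<bar>"
          using abs_triangle_ineq[of "(\<delta> k x)\<^sup>2" "2 * H (fst x) (snd x) * \<delta> k x"] by simp
        also have "\<bar>2 * H (fst x) (snd x) * \<delta> k x\<bar> \<le> 2 * K * \<bar>\<delta> k x\<bar>"
          using H_le[of "fst x" "snd x"] that by (auto simp: abs_mult spN intro!: mult_right_mono)
        finally show ?thesis by (simp add: h_def)
      qed
      then have "ennreal (h k x) \<le> ennreal ((\<delta> k x)\<^sup>2) + ennreal (2 * K) * ennreal \<bar>\<delta> k x\<bar>" if "x \<in> space N" for x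
        using that K by (simp add: ennreal_plus[symmetric] ennreal_mult[symmetric] ennreal_leI del: ennreal_plus)
      then have "(\<integral>\<^sup>+x. ennreal (h k x) \<partial>N) \<le>
          (\<integral>\<^sup>+x. ennreal ((\<delta> k x)\<^sup>2) + ennreal (2 * K) * ennreal \<bar>\<delta> k x\<bar> \<partial>N)"
        by (rule nn_integral_mono)
      also have "\<dots> = (\<integral>\<^sup>+x. ennreal ((\<delta> k x)\<^sup>2) \<partial>N) + ennreal (2 * K) * (\<integral>\<^sup>+x. ennreal \<bar>\<delta> k x\<bar> \<partial>N)"
        by (subst nn_integral_add) (auto simp: nn_integral_cmult)
      finally show ?thesis
        using nn_integral_eq_integral[OF h_int[of k]] by (simp add: h_def)
    qed
    ultimately have "(\<lambda>k. ennreal (integral\<^sup>L N (h k))) \<longlonglongrightarrow> 0"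
      by (intro tendsto_sandwich[where f = "\<lambda>_. 0" and g = "\<lambda>k. ennreal (integral\<^sup>L N (h k))",
            OF _ _ tendsto_const] always_eventually allI) auto
    then show "(\<lambda>k. \<integral>s. \<alpha> k s \<partial>R) \<longlonglongrightarrow> 0"
      unfolding eq by (subst (asm) ennreal_tendsto_0_iff) (auto simp: h_def intro!: integral_nonneg_AE)
  qed

  have X_lim: "(\<lambda>k. \<integral>\<^sup>+\<omega>. ennreal ((X k s \<omega> - Y s \<omega>)\<^sup>2) \<partial>M) \<longlonglongrightarrow> 0" if s: "s \<in> {0..T}" for s
  proof -
    have "(\<integral>\<^sup>+\<omega>. ennreal ((X k s \<omega> - Y s \<omega>)\<^sup>2) \<partial>M) =
        (\<integral>\<^sup>+\<omega>. ennreal ((simple_integral W (n k) (\<tau> k) (\<xi> k) s \<omega> - I s \<omega>)\<^sup>2) \<partial>M)" for k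
      using Y_eq[OF s] by (intro nn_integral_cong_AE, eventually_elim) (simp add: X_def)
    then show ?thesis using lim_I[OF s] by simp
  qed
  \<comment> \<open>The error from replacing \<open>f'' (Y s)\<close> by \<open>f'' (X k s)\<close>.\<close>
  define e where "e k s = expectation (\<lambda>\<omega>. \<bar>f'' (X k s \<omega>) - f'' (Y s \<omega>)\<bar>)" for k s
  have e_lim: "(\<lambda>k. e k s) \<longlonglongrightarrow> 0" if "s \<in> {0..T}" for s
    unfolding e_def
    by (rule expectation_lipschitz_tendsto[OF XM Y _ X_lim lipschitz2 bound2]) (use that in auto)
  have e_int: "integrable M (\<lambda>\<omega>. \<bar>f'' (X k s \<omega>) - f'' (Y s \<omega>)\<bar>)" and e_le: "e k s \<le> 2 * B"
    if s: "s \<in> {0..T}" for k s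
  proof -
    have [measurable]: "X k s \<in> borel_measurable M" "Y s \<in> borel_measurable M"
      using XM Y s by auto
    have *: "\<bar>\<bar>f'' (X k s \<omega>) - f'' (Y s \<omega>)\<bar>\<bar> \<le> 2 * B" for \<omega>
      using bound2[of "X k s \<omega>"] bound2[of "Y s \<omega>"] by linarith
    show i: "integrable M (\<lambda>\<omega>. \<bar>f'' (X k s \<omega>) - f'' (Y s \<omega>)\<bar>)"
      by (rule integrable_bounded[where C = "2 * B"]) (use * in auto)
    have "e k s \<le> expectation (\<lambda>\<omega>. 2 * B)"
      unfolding e_def using i * by (intro integral_mono) auto
    then show "e k s \<le> 2 * B" by (simp add: prob_space)
  qed

  define G where "G s = expectation (\<lambda>\<omega>. f'' (Y s \<omega>) * (H s \<omega>)\<^sup>2 / 2)" for s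
  define Gk where "Gk k s = expectation (\<lambda>\<omega>. f'' (X k s \<omega>) * (S k s \<omega>)\<^sup>2 / 2)" for k s
  have G_diff: "\<bar>Gk k s - G s\<bar> \<le> B * \<alpha> k s + K\<^sup>2 * e k s" and G_le: "\<bar>G s\<bar> \<le> B * K\<^sup>2" if s: "s \<in> {0..T}" for k s
  proof -
    have [measurable]: "X k s \<in> borel_measurable M" "Y s \<in> borel_measurable M"
        "S k s \<in> borel_measurable M" "H s \<in> borel_measurable M"
      using XM Y SM HM s by auto
    obtain C where C: "0 \<le> C" "\<And>\<omega>. \<omega> \<in> space M \<Longrightarrow> (S k s \<omega>)\<^sup>2 \<le> C"
        "\<And>\<omega>. \<omega> \<in> space M \<Longrightarrow> \<bar>(S k s \<omega>)\<^sup>2 - (H s \<omega>)\<^sup>2\<bar> \<le> C"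
      using S_bdd[of k] s by blast
    have H2: "(H s \<omega>)\<^sup>2 \<le> K\<^sup>2" if "\<omega> \<in> space M" for \<omega>
      using H_le[OF s that] by (simp add: abs_le_square_iff[symmetric])
    have half: "\<bar>f'' x * y / 2\<bar> \<le> B * c" if "0 \<le> y" "y \<le> c" for x y c
    proof -
      have "\<bar>f'' x\<bar> * \<bar>y\<bar> \<le> B * c" using that by (intro mult_mono bound2) (auto simp: B_nonneg)
      moreover have "0 \<le> \<bar>f'' x\<bar> * \<bar>y\<bar>" by simp
      ultimately show ?thesis unfolding abs_mult abs_divide abs_numeral by linarith
    qed
    have iS: "integrable M (\<lambda>\<omega>. f'' (X k s \<omega>) * (S k s \<omega>)\<^sup>2 / 2)"
      by (rule integrable_bounded[where C = "B * C"]) (use half C in auto)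
    have iH: "integrable M (\<lambda>\<omega>. f'' (Y s \<omega>) * (H s \<omega>)\<^sup>2 / 2)"
      by (rule integrable_bounded[where C = "B * K\<^sup>2"]) (use half H2 in auto)
    have i\<alpha>: "integrable M (\<lambda>\<omega>. \<bar>(S k s \<omega>)\<^sup>2 - (H s \<omega>)\<^sup>2\<bar>)"
      by (rule integrable_bounded[where C = C]) (use C in auto)
    have "\<bar>G s\<bar> \<le> expectation (\<lambda>\<omega>. B * K\<^sup>2)"
      unfolding G_def using iH half H2 by (intro abs_integral_le) auto
    then show "\<bar>G s\<bar> \<le> B * K\<^sup>2" by (simp add: prob_space)
    have diff: "Gk k s - G s = expectation (\<lambda>\<omega>. f'' (X k s \<omega>) * (S k s \<omega>)\<^sup>2 / 2 - f'' (Y s \<omega>) * (H s \<omega>)\<^sup>2 / 2)"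
      unfolding G_def Gk_def using iS iH by simp
    have "\<bar>Gk k s - G s\<bar> \<le> expectation (\<lambda>\<omega>. B * \<bar>(S k s \<omega>)\<^sup>2 - (H s \<omega>)\<^sup>2\<bar> + K\<^sup>2 * \<bar>f'' (X k s \<omega>) - f'' (Y s \<omega>)\<bar>)"
      unfolding diff
    proof (rule abs_integral_le)
      fix \<omega> assume \<omega>: "\<omega> \<in> space M"
      let ?a = "f'' (X k s \<omega>) * ((S k s \<omega>)\<^sup>2 - (H s \<omega>)\<^sup>2)"
      let ?b = "(f'' (X k s \<omega>) - f'' (Y s \<omega>)) * (H s \<omega>)\<^sup>2"
      have half_sum: "\<bar>x\<bar> \<le> p + q" if "x = (a + b) / 2" "\<bar>a\<bar> \<le> p" "\<bar>b\<bar> \<le> q" for x a b p q :: real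
      proof -
        have "\<bar>a + b\<bar> \<le> p + q" using abs_triangle_ineq add_mono[OF that(2,3)] by (rule order_trans)
        moreover have "\<bar>x\<bar> = \<bar>a + b\<bar> / 2" "\<bar>a + b\<bar> / 2 \<le> \<bar>a + b\<bar>" using that(1) by simp_all
        ultimately show ?thesis by (metis order_trans)
      qed
      show "\<bar>f'' (X k s \<omega>) * (S k s \<omega>)\<^sup>2 / 2 - f'' (Y s \<omega>) * (H s \<omega>)\<^sup>2 / 2\<bar> \<le>
          B * \<bar>(S k s \<omega>)\<^sup>2 - (H s \<omega>)\<^sup>2\<bar> + K\<^sup>2 * \<bar>f'' (X k s \<omega>) - f'' (Y s \<omega>)\<bar>"
      proof (rule half_sum)
        show "f'' (X k s \<omega>) * (S k s \<omega>)\<^sup>2 / 2 - f'' (Y s \<omega>) * (H s \<omega>)\<^sup>2 / 2 = (?a + ?b) / 2"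
          by (simp add: algebra_simps diff_divide_distrib)
        show "\<bar>?a\<bar> \<le> B * \<bar>(S k s \<omega>)\<^sup>2 - (H s \<omega>)\<^sup>2\<bar>"
          unfolding abs_mult by (intro mult_right_mono bound2) simp
        show "\<bar>?b\<bar> \<le> K\<^sup>2 * \<bar>f'' (X k s \<omega>) - f'' (Y s \<omega>)\<bar>"
          unfolding abs_mult mult.commute[of "\<bar>f'' (X k s \<omega>) - f'' (Y s \<omega>)\<bar>"]
          using H2[OF \<omega>] by (intro mult_right_mono) auto
      qed
    qed (intro Bochner_Integration.integrable_diff Bochner_Integration.integrable_add
        integrable_mult_right iS iH i\<alpha> e_int[OF s])+
    also have "\<dots> = B * \<alpha> k s + K\<^sup>2 * e k s"
      using Bochner_Integration.integral_add[OF integrable_mult_right[OF i\<alpha>, of B]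
          integrable_mult_right[OF e_int[OF s], of "K\<^sup>2"]]
      unfolding \<alpha>_def e_def integral_mult_right_zero .
    finally show "\<bar>Gk k s - G s\<bar> \<le> B * \<alpha> k s + K\<^sup>2 * e k s" .
  qed

  define g where "g s = indicator {0..t} s * G s" for s
  define gk where "gk k s = indicator {0..t} s * Gk k s" for k s
  have gk: "has_bochner_integral lborel (gk k)
      (expectation (\<lambda>\<omega>. f (X k t \<omega>)) - expectation (\<lambda>\<omega>. f (Y 0 \<omega>)))" for k
    unfolding gk_def[abs_def] Gk_def X_def S_def
    by (rule ito_expectation_simple_process[OF f data Y0 t])
  have [measurable]: "g \<in> borel_measurable borel"
    using drift unfolding g_def[abs_def] G_def by simp
  have [measurable]: "gk k \<in> borel_measurable borel" for k
    using borel_measurable_has_bochner_integral[OF gk[of k]] by simp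
  have g_int: "integrable lborel g"
  proof (rule Bochner_Integration.integrable_bound)
    show "integrable lborel (\<lambda>s. indicator {0..t} s * (B * K\<^sup>2) :: real)"
      by (intro integrable_mult_left integrable_real_indicator) (auto simp: emeasure_lborel_Icc_eq)
    show "AE s in lborel. norm (g s) \<le> norm (indicator {0..t} s * (B * K\<^sup>2))"
      using G_le t B_nonneg by (auto simp: g_def split: split_indicator)
  qed simp
  define a where "a k s = B * (indicator {0..T} s * \<alpha> k s)" for k s
  have a_int: "integrable lborel (a k)" for k
    using \<alpha>_int[of k] by (simp add: a_def[abs_def] R_def integrable_restrict_space)
  have a_lim: "(\<lambda>k. integral\<^sup>L lborel (a k)) \<longlonglongrightarrow> 0"
    using tendsto_mult_left[OF \<alpha>_lim, of B]
    by (simp add: a_def[abs_def] R_def integral_restrict_space)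
  \<comment> \<open>The part of the error not controlled by \<open>a k\<close>. It is measurable in \<open>s\<close> because both integrands
      are, whereas the measurability of \<open>e k\<close> would require joint measurability of \<open>X k\<close> and \<open>Y\<close>.\<close>
  define r where "r k s = max 0 (\<bar>gk k s - g s\<bar> - a k s)" for k s
  have [measurable]: "r k \<in> borel_measurable borel" for k
    unfolding r_def using a_int[of k] by measurable
  have r_le: "r k s \<le> indicator {0..T} s * (K\<^sup>2 * e k s)" for k s
  proof -
    have e0: "0 \<le> e k s" unfolding e_def by simp
    have \<alpha>0: "0 \<le> B * \<alpha> k s" unfolding \<alpha>_def by (simp add: B_nonneg)
    consider "s \<in> {0..t}" | "s \<notin> {0..t}" "s \<in> {0..T}" | "s \<notin> {0..T}" "s \<notin> {0..t}" using t by force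
    then show ?thesis
    proof cases
      case 1
      then have "s \<in> {0..T}" using t by auto
      with 1 G_diff[of s k] e0 show ?thesis by (simp add: r_def gk_def g_def a_def)
    next
      case 2
      then show ?thesis using e0 \<alpha>0 by (simp add: r_def gk_def g_def a_def)
    next
      case 3
      then show ?thesis by (simp add: r_def gk_def g_def a_def)
    qed
  qed
  have r_bound: "norm (r k s) \<le> indicator {0..T} s * (K\<^sup>2 * (2 * B))" for k s
  proof -
    have "0 \<le> r k s" by (simp add: r_def)
    moreover have "indicator {0..T} s * (K\<^sup>2 * e k s) \<le> indicator {0..T} s * (K\<^sup>2 * (2 * B))"
      using e_le[of s k] by (auto intro: mult_left_mono split: split_indicator)
    ultimately show ?thesis using r_le[of k s] by simp
  qed
  have dom: "integrable lborel (\<lambda>s. indicator {0..T} s * (K\<^sup>2 * (2 * B)) :: real)"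
    by (intro integrable_mult_left integrable_real_indicator) (auto simp: emeasure_lborel_Icc_eq)
  have r_int: "integrable lborel (r k)" for k
  proof (rule Bochner_Integration.integrable_bound[OF dom])
    show "AE s in lborel. norm (r k s) \<le> norm (indicator {0..T} s * (K\<^sup>2 * (2 * B)))"
      using r_bound[of k] B_nonneg by (auto simp: abs_mult)
  qed simp
  have "(\<lambda>k. integral\<^sup>L lborel (r k)) \<longlonglongrightarrow> (LINT s::real|lborel. 0)"
  proof (rule integral_dominated_convergence[OF _ _ dom])
    have "(\<lambda>k. r k s) \<longlonglongrightarrow> 0" for s
    proof (cases "s \<in> {0..T}")
      case True
      have "(\<lambda>k. K\<^sup>2 * e k s) \<longlonglongrightarrow> 0" using tendsto_mult_left[OF e_lim[OF True], of "K\<^sup>2"] by simp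
      then show ?thesis
        by (rule Lim_null_comparison[rotated]) (use r_le[of _ s] True in \<open>auto simp: r_def\<close>)
    next
      case False
      then have "r k s = 0" for k using r_le[of k s] by (simp add: r_def)
      then show ?thesis by simp
    qed
    then show "AE s in lborel. (\<lambda>k. r k s) \<longlonglongrightarrow> 0" by simp
    show "AE s in lborel. norm (r k s) \<le> indicator {0..T} s * (K\<^sup>2 * (2 * B))" for k
      using r_bound by simp
  qed auto
  then have "(\<lambda>k. integral\<^sup>L lborel (a k) + integral\<^sup>L lborel (r k)) \<longlonglongrightarrow> 0"
    using tendsto_add[OF a_lim] by simp
  moreover have "(LINT s|lborel. \<bar>gk k s - g s\<bar>) \<le> integral\<^sup>L lborel (a k) + integral\<^sup>L lborel (r k)" for k
  proof -
    have "(LINT s|lborel. \<bar>gk k s - g s\<bar>) \<le> (LINT s|lborel. a k s + r k s)"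
      using g_int gk[THEN integrable.intros, of k] a_int[of k] r_int[of k]
      by (intro integral_mono) (auto simp: r_def)
    then show ?thesis using a_int[of k] r_int[of k] by simp
  qed
  ultimately have "(\<lambda>k. LINT s|lborel. \<bar>gk k s - g s\<bar>) \<longlonglongrightarrow> 0"
    by (intro tendsto_sandwich[where f = "\<lambda>_. 0" and g = "\<lambda>k. LINT s|lborel. \<bar>gk k s - g s\<bar>",
          OF _ _ tendsto_const] always_eventually allI) auto
  then have lim1: "(\<lambda>k. integral\<^sup>L lborel (gk k)) \<longlonglongrightarrow> integral\<^sup>L lborel g"
    using g_int gk[THEN integrable.intros] by (intro tendsto_integral_of_L1) auto

  have f_int: "integrable M (\<lambda>\<omega>. f (Z \<omega>))" if "Z \<in> borel_measurable M" for Z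
    using that by (intro integrable_bounded[where C = B]) (auto intro: bound0)
  have "(\<lambda>k. expectation (\<lambda>\<omega>. f (X k t \<omega>))) \<longlonglongrightarrow> expectation (\<lambda>\<omega>. f (Y t \<omega>))"
    by (rule tendsto_integral_of_L1[OF f_int f_int
          expectation_lipschitz_tendsto[OF XM Y _ X_lim lipschitz bound0]]) (use t XM Y in auto)
  then have "(\<lambda>k. integral\<^sup>L lborel (gk k)) \<longlonglongrightarrow>
      expectation (\<lambda>\<omega>. f (Y t \<omega>)) - expectation (\<lambda>\<omega>. f (Y 0 \<omega>))"
    unfolding has_bochner_integral_integral_eq[OF gk] by (intro tendsto_diff tendsto_const)
  from LIMSEQ_unique[OF lim1 this]
  have "(LINT s|lborel. indicator {0..t} s * expectation (\<lambda>\<omega>. f'' (Y s \<omega>) * (H s \<omega>)\<^sup>2 / 2)) =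
      expectation (\<lambda>\<omega>. f (Y t \<omega>)) - expectation (\<lambda>\<omega>. f (Y 0 \<omega>))"
    unfolding g_def[abs_def] G_def .
  then show ?thesis by linarith
qed

end

section \<open>From stochastic to partial differential equations\<close>

text \<open>
  The Ito formula in expectation, applied to a test function and written with the densities of
  \<open>Y s\<close>, is the weak formulation of the linear equation. The joint measurability of \<open>v\<close> makes the
  drift measurable in time, and \<open>v\<close> has mass 1 at each time, hence mass \<open>T\<close> on the strip
  \<open>[0, T] \<times> \<real>\<close>, which with the bound on \<open>\<sigma>\<close> makes the flux integrable.
\<close>

lemma distributional_solution_of_sde:
  fixes \<sigma> v :: "real \<Rightarrow> real \<Rightarrow> real"
  assumes T: "0 \<le> T"
    and sde: "sde_solution T \<sigma> M F W Y"
    and law: "has_law_density T M Y v"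
    and \<sigma>_meas: "set_borel_measurable lborel ({0..T} \<times> UNIV) (\<lambda>(t, x). \<sigma> t x)"
    and \<sigma>_le: "\<And>s x. s \<in> {0..T} \<Longrightarrow> \<bar>\<sigma> s x\<bar> \<le> K"
    and u0: "\<And>x. 0 \<le> u0 x" "distributed M lborel (Y 0) (\<lambda>x. ennreal (u0 x))"
  shows "distributional_solution T v (\<lambda>s x. (\<sigma> s x)\<^sup>2 * v s x) u0"
proof -
  interpret prob_space M using sde by (simp add: sde_solution_def filtered_prob_space_def)
  interpret brownian_space M F W using sde by unfold_locales (simp_all add: sde_solution_def)
  \<comment> \<open>Extensions by 0 to the plane, which are Borel functions without restriction of the domain.\<close>
  define v' where "v' p = indicator ({0..T} \<times> UNIV) p * v (fst p) (snd p)" for p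
  define \<sigma>' where "\<sigma>' p = indicator ({0..T} \<times> UNIV) p * \<sigma> (fst p) (snd p)" for p
  have v_meas: "set_borel_measurable lborel ({0..T} \<times> UNIV) (\<lambda>(t, x). v t x)"
    using law by (simp add: has_law_density_def)
  have [measurable]: "v' \<in> borel_measurable (lborel \<Otimes>\<^sub>M lborel)" "\<sigma>' \<in> borel_measurable (lborel \<Otimes>\<^sub>M lborel)"
    using v_meas \<sigma>_meas
    by (simp_all add: set_borel_measurable_def v'_def[abs_def] \<sigma>'_def[abs_def] lborel_prod case_prod_unfold)
  have v'_eq: "v' (s, x) = v s x" and \<sigma>'_eq: "\<sigma>' (s, x) = \<sigma> s x" if "s \<in> {0..T}" for s x
    using that by (simp_all add: v'_def \<sigma>'_def)
  have v_nonneg: "0 \<le> v s x" and v_law: "distributed M lborel (Y s) (\<lambda>x. ennreal (v s x))"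
    if "s \<in> {0..T}" for s x
    using law that by (simp_all add: has_law_density_def)
  have \<sigma>_section: "\<sigma> s \<in> borel_measurable lborel" if "s \<in> {0..T}" for s
  proof -
    have "(\<lambda>x. \<sigma>' (s, x)) \<in> borel_measurable lborel" by measurable
    then show ?thesis unfolding \<sigma>'_eq[OF that] .
  qed
  have v_int: "integrable lborel (v s)" and v_one: "(LINT x|lborel. v s x) = 1" if s: "s \<in> {0..T}" for s
    using distributed_integrable[OF v_law[OF s], of "\<lambda>_. 1"] distributed_integral[OF v_law[OF s], of "\<lambda>_. 1"]
      v_nonneg[OF s] by (simp_all add: prob_space)
  have v'_int: "integrable (lborel \<Otimes>\<^sub>M lborel) v'"
  proof (rule integrableI_bounded)
    have "(\<integral>\<^sup>+x. ennreal (norm (v' (s, x))) \<partial>lborel) = indicator {0..T} s" for s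
    proof (cases "s \<in> {0..T}")
      case True
      then show ?thesis
        using v_int[OF True] v_nonneg[OF True] v_one[OF True] by (simp add: v'_eq nn_integral_eq_integral)
    next
      case False
      then show ?thesis by (auto simp: v'_def)
    qed
    then have "(\<integral>\<^sup>+p. ennreal (norm (v' p)) \<partial>(lborel \<Otimes>\<^sub>M lborel)) = (\<integral>\<^sup>+s. indicator {0..T} s \<partial>lborel)"
      by (subst lborel.nn_integral_fst[symmetric]) simp_all
    then show "(\<integral>\<^sup>+p. ennreal (norm (v' p)) \<partial>(lborel \<Otimes>\<^sub>M lborel)) < \<infinity>" using T by simp
  qed measurable
  show ?thesis
    unfolding distributional_solution_def
  proof (intro conjI allI ballI impI)
    show "set_borel_measurable lborel ({0..T} \<times> UNIV) (\<lambda>(t, x). v t x)" by (rule v_meas)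
    show "set_integrable lborel {-R..R} (v t)" if "t \<in> {0..T}" for t R
      unfolding set_integrable_def using v_int[OF that] by (intro integrable_mult_indicator) auto
    show "set_integrable lborel ({0..T} \<times> {-R..R}) (\<lambda>(t, x). (\<sigma> t x)\<^sup>2 * v t x)" for R
      unfolding set_integrable_def lborel_prod[symmetric]
    proof (rule Bochner_Integration.integrable_bound)
      show "integrable (lborel \<Otimes>\<^sub>M lborel) (\<lambda>p. K\<^sup>2 * v' p)" using v'_int by simp
      have eq: "indicator ({0..T} \<times> {-R..R}) p *\<^sub>R (case p of (t, x) \<Rightarrow> (\<sigma> t x)\<^sup>2 * v t x) =
          indicator (UNIV \<times> {-R..R}) p * ((\<sigma>' p)\<^sup>2 * v' p)" for p
        by (cases p) (auto simp: v'_def \<sigma>'_def split: split_indicator)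
      have [measurable]: "(UNIV :: real set) \<times> {-R..R} \<in> sets (lborel \<Otimes>\<^sub>M lborel)"
        by (intro pair_measureI) auto
      show "(\<lambda>p. indicator ({0..T} \<times> {-R..R}) p *\<^sub>R (case p of (t, x) \<Rightarrow> (\<sigma> t x)\<^sup>2 * v t x))
          \<in> borel_measurable (lborel \<Otimes>\<^sub>M lborel)"
        unfolding eq by measurable
      have "norm (indicator (UNIV \<times> {-R..R}) p * ((\<sigma>' p)\<^sup>2 * v' p)) \<le> norm (K\<^sup>2 * v' p)" for p
      proof (cases "fst p \<in> {0..T}")
        case True
        then have "(\<sigma>' p)\<^sup>2 \<le> K\<^sup>2"
          using \<sigma>_le[OF True, of "snd p"] \<sigma>'_eq[OF True, of "snd p"] by (simp add: abs_le_square_iff[symmetric])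
        then have "(\<sigma>' p)\<^sup>2 * \<bar>v' p\<bar> \<le> K\<^sup>2 * \<bar>v' p\<bar>" by (intro mult_right_mono) auto
        then show ?thesis by (auto simp: abs_mult split: split_indicator)
      next
        case False
        then show ?thesis by (auto simp: v'_def indicator_def mem_Times_iff)
      qed
      then show "AE p in lborel \<Otimes>\<^sub>M lborel. norm (indicator ({0..T} \<times> {-R..R}) p *\<^sub>R
          (case p of (t, x) \<Rightarrow> (\<sigma> t x)\<^sup>2 * v t x)) \<le> norm (K\<^sup>2 * v' p)"
        unfolding eq by simp
    qed
  next
    fix \<phi> :: "real \<Rightarrow> real" and t assume \<phi>: "test_function \<phi>" and t: "t \<in> {0..T}"
    obtain B where B: "bounded_C3 \<phi> (deriv \<phi>) ((deriv ^^ 2) \<phi>) ((deriv ^^ 3) \<phi>) B"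
      using test_function_imp_bounded_C3[OF \<phi>] .
    note [measurable] = bounded_C3.borel_measurable_derivs(1,3)[OF B]
    let ?d = "\<lambda>s. LINT x|lborel. (deriv ^^ 2) \<phi> x * ((\<sigma> s x)\<^sup>2 * v s x)"
    have Y_meas: "Y s \<in> borel_measurable (F s)" if "s \<in> {0..T}" for s
      using sde that by (simp add: sde_solution_def adapted_on_def)
    obtain I where I: "has_ito_integral M F W T (\<lambda>s \<omega>. \<sigma> s (Y s \<omega>)) I"
        and Y_eq: "\<And>s. s \<in> {0..T} \<Longrightarrow> AE \<omega> in M. Y s \<omega> = Y 0 \<omega> + I s \<omega>"
      using sde unfolding sde_solution_def by blast
    have drift: "expectation (\<lambda>\<omega>. (deriv ^^ 2) \<phi> (Y s \<omega>) * (\<sigma> s (Y s \<omega>))\<^sup>2 / 2) = ?d s / 2"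
      if s: "s \<in> {0..T}" for s
    proof -
      have [measurable]: "\<sigma> s \<in> borel_measurable lborel" by (rule \<sigma>_section[OF s])
      have "expectation (\<lambda>\<omega>. (deriv ^^ 2) \<phi> (Y s \<omega>) * (\<sigma> s (Y s \<omega>))\<^sup>2 / 2) =
          (LINT x|lborel. v s x * ((deriv ^^ 2) \<phi> x * (\<sigma> s x)\<^sup>2 / 2))"
        by (rule distributed_integral[OF v_law[OF s], symmetric]) (use v_nonneg[OF s] in auto)
      also have "\<dots> = (LINT x|lborel. (deriv ^^ 2) \<phi> x * ((\<sigma> s x)\<^sup>2 * v s x) / 2)"
        by (intro Bochner_Integration.integral_cong) (auto simp: algebra_simps)
      finally show ?thesis by simp
    qed
    then have drift_eq: "(\<lambda>s. indicator {0..t} s *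
          expectation (\<lambda>\<omega>. (deriv ^^ 2) \<phi> (Y s \<omega>) * (\<sigma> s (Y s \<omega>))\<^sup>2 / 2)) =
        (\<lambda>s. indicator {0..t} s * (?d s / 2))"
      using t by (auto simp: fun_eq_iff split: split_indicator)
    also have "\<dots> = (\<lambda>s. indicator {0..t} s *
        ((LINT x|lborel. (deriv ^^ 2) \<phi> x * ((\<sigma>' (s, x))\<^sup>2 * v' (s, x))) / 2))"
      using t by (auto simp: fun_eq_iff \<sigma>'_eq v'_eq split: split_indicator)
    also have "\<dots> \<in> borel_measurable lborel" by measurable
    finally have drift_meas: "(\<lambda>s. indicator {0..t} s *
        expectation (\<lambda>\<omega>. (deriv ^^ 2) \<phi> (Y s \<omega>) * (\<sigma> s (Y s \<omega>))\<^sup>2 / 2)) \<in> borel_measurable lborel" .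
    have YM: "Y s \<in> borel_measurable M" if "s \<in> {0..T}" for s
      using that by (intro measurable_filtration_M[OF _ Y_meas]) auto
    have "expectation (\<lambda>\<omega>. \<phi> (Y t \<omega>)) = expectation (\<lambda>\<omega>. \<phi> (Y 0 \<omega>)) +
        (LINT s|lborel. indicator {0..t} s * (?d s / 2))"
      unfolding drift_eq[symmetric]
      by (rule ito_expectation[OF B I _ YM _ Y_eq t drift_meas]) (use \<sigma>_le Y_meas[of 0] T in auto)
    moreover have "(LINT x|lborel. \<phi> x * v t x) = expectation (\<lambda>\<omega>. \<phi> (Y t \<omega>))"
      using distributed_integral[OF v_law[OF t], of \<phi>] v_nonneg[OF t] by (simp add: mult.commute)
    moreover have "(LINT x|lborel. \<phi> x * u0 x) = expectation (\<lambda>\<omega>. \<phi> (Y 0 \<omega>))"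
      using distributed_integral[OF u0(2), of \<phi>] u0(1) by (simp add: mult.commute)
    moreover have "(LINT s|lborel. indicator {0..t} s * (?d s / 2)) = 1/2 * (LINT s:{0..t}|lborel. ?d s)"
      unfolding set_lebesgue_integral_def by simp
    ultimately show "(LINT x|lborel. \<phi> x * v t x) = (LINT x|lborel. \<phi> x * u0 x) +
        1/2 * (LINT s:{0..t}|lborel. ?d s)"
      by simp
  qed
qed

text \<open>
  The function \<open>\<Phi>\<close> applied to the cut-off of \<open>u\<close> is measurable and equals \<open>\<Phi> (u x)\<close> on \<open>A\<close>;
  outside \<open>A\<close> its value is \<open>\<Phi> 0\<close>, which a second cut-off removes.
\<close>

lemma set_borel_measurable_compose:
  fixes \<Phi> :: "real \<Rightarrow> real"
  assumes A: "A \<in> sets M" and "\<Phi> \<in> borel_measurable borel" and u: "set_borel_measurable M A u"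
  shows "set_borel_measurable M A (\<lambda>x. \<Phi> (u x))"
proof -
  have "(\<lambda>x. indicator A x *\<^sub>R \<Phi> (indicator A x *\<^sub>R u x)) \<in> borel_measurable M"
    using A measurable_compose[OF u[unfolded set_borel_measurable_def] assms(2)]
    by (intro borel_measurable_scaleR) auto
  also have "(\<lambda>x. indicator A x *\<^sub>R \<Phi> (indicator A x *\<^sub>R u x)) = (\<lambda>x. indicator A x *\<^sub>R \<Phi> (u x))"
    by (auto simp: fun_eq_iff split: split_indicator)
  finally show ?thesis by (simp add: set_borel_measurable_def)
qed

theorem theorem1p4:
  fixes T :: real and \<beta> \<Phi> u0 :: "real \<Rightarrow> real"
  assumes T_pos: "T > 0"
    and beta_mono: "mono \<beta>"
    and beta_linear_growth: "\<exists>C. \<forall>x. \<bar>\<beta> x\<bar> \<le> C * \<bar>x\<bar>"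
    and beta_lambda: "\<exists>l>0. filterlim (\<lambda>x. \<beta> x + l * x) at_top at_top \<and>
                            filterlim (\<lambda>x. \<beta> x + l * x) at_bot at_bot"
    and Phi_Borel: "\<Phi> \<in> borel_measurable borel"
    and Phi_nonneg: "\<forall>x. 0 \<le> \<Phi> x"
    and Phi_bounded: "\<exists>C. \<forall>x. \<Phi> x \<le> C"
    and beta_Phi: "\<forall>x. \<beta> x = (\<Phi> x)\<^sup>2 * x"
    and u0_nonneg: "\<forall>x. 0 \<le> u0 x"
    and u0_L1: "integrable lborel u0"
    and u0_prob: "(LINT x|lborel. u0 x) = 1"
    and u0_Linf: "\<exists>C. AE x in lborel. \<bar>u0 x\<bar> \<le> C"
  shows
    "(\<forall>u :: real \<Rightarrow> real \<Rightarrow> real.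
        u 0 = u0 \<and>
        (\<exists>(M :: 'a measure) F W Y.
           sde_solution T (\<lambda>s x. \<Phi> (u s x)) M F W Y \<and> has_law_density T M Y u)
        \<longrightarrow> distributional_solution T u (\<lambda>s x. \<beta> (u s x)) u0)
     \<and>
     (\<forall>(u :: real \<Rightarrow> real \<Rightarrow> real) (v :: real \<Rightarrow> real \<Rightarrow> real) (M :: 'a measure) F W Y.
        distributional_solution T u (\<lambda>s x. \<beta> (u s x)) u0 \<and> u 0 = u0 \<and>
        sde_solution T (\<lambda>s x. \<Phi> (u s x)) M F W Y \<and> has_law_density T M Y v \<and>
        distributed M lborel (Y 0) (\<lambda>x. ennreal (u0 x))
        \<longrightarrow> distributional_solution T v (\<lambda>s x. (\<Phi> (u s x))\<^sup>2 * v s x) u0 \<and>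
            (unique_linear_solution T (\<lambda>s x. (\<Phi> (u s x))\<^sup>2) u0 v \<longrightarrow>
               (\<forall>t\<in>{0..T}. AE x in lborel. v t x = u t x)))"
proof (intro conjI allI impI)
  obtain C where C: "\<And>x. \<Phi> x \<le> C" using Phi_bounded by blast
  have \<beta>: "(\<lambda>s x. \<beta> (w s x)) = (\<lambda>s x. (\<Phi> (w s x))\<^sup>2 * w s x)" for w :: "real \<Rightarrow> real \<Rightarrow> real"
    using beta_Phi by simp
  have coefficient: "set_borel_measurable lborel ({0..T} \<times> UNIV) (\<lambda>(t, x). \<Phi> (w t x))"
    if "set_borel_measurable lborel ({0..T} \<times> UNIV) (\<lambda>(t, x). w t x)" for w :: "real \<Rightarrow> real \<Rightarrow> real"
  proof -
    have "{0..T} \<times> (UNIV :: real set) \<in> sets lborel" by (simp add: borel_Times)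
    from set_borel_measurable_compose[OF this Phi_Borel that] show ?thesis
      by (simp add: case_prod_unfold)
  qed
  have linear: "distributional_solution T v (\<lambda>s x. (\<Phi> (w s x))\<^sup>2 * v s x) u0"
    if "set_borel_measurable lborel ({0..T} \<times> UNIV) (\<lambda>(t, x). w t x)"
      "sde_solution T (\<lambda>s x. \<Phi> (w s x)) M F W Y" "has_law_density T M Y v"
      "distributed M lborel (Y 0) (\<lambda>x. ennreal (u0 x))"
    for w v :: "real \<Rightarrow> real \<Rightarrow> real" and M :: "'a measure" and F W Y
    using distributional_solution_of_sde[OF _ that(2,3) coefficient[OF that(1)], of C u0]
      T_pos C Phi_nonneg u0_nonneg that(4) by simp
  {
    fix u
    assume "u 0 = u0 \<and> (\<exists>(M :: 'a measure) F W Y.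
        sde_solution T (\<lambda>s x. \<Phi> (u s x)) M F W Y \<and> has_law_density T M Y u)"
    then obtain M :: "'a measure" and F W Y where u: "u 0 = u0"
      "sde_solution T (\<lambda>s x. \<Phi> (u s x)) M F W Y" "has_law_density T M Y u" by blast
    have "distributed M lborel (Y 0) (\<lambda>x. ennreal (u0 x))"
      using u(3) T_pos unfolding has_law_density_def u(1)[symmetric] by simp
    then show "distributional_solution T u (\<lambda>s x. \<beta> (u s x)) u0"
      unfolding \<beta> using u(2,3) by (intro linear) (auto simp: has_law_density_def)
  }
  {
    fix u v and M :: "'a measure" and F W Y
    assume a: "distributional_solution T u (\<lambda>s x. \<beta> (u s x)) u0 \<and> u 0 = u0 \<and>
        sde_solution T (\<lambda>s x. \<Phi> (u s x)) M F W Y \<and> has_law_density T M Y v \<and>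
        distributed M lborel (Y 0) (\<lambda>x. ennreal (u0 x))"
    then have u: "distributional_solution T u (\<lambda>s x. (\<Phi> (u s x))\<^sup>2 * u s x) u0" by (simp add: \<beta>)
    show "distributional_solution T v (\<lambda>s x. (\<Phi> (u s x))\<^sup>2 * v s x) u0"
      using a by (intro linear) (auto simp: distributional_solution_def)
    assume uniq: "unique_linear_solution T (\<lambda>s x. (\<Phi> (u s x))\<^sup>2) u0 v"
    show "\<forall>t\<in>{0..T}. AE x in lborel. v t x = u t x"
    proof
      fix t assume "t \<in> {0..T}"
      then have "AE x in lborel. u t x = v t x"
        using uniq u unfolding unique_linear_solution_def by blast
      then show "AE x in lborel. v t x = u t x" by eventually_elim simp
    qed
  }
qed

end
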